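(* Let $T=T_2\circ T_1$ be the return map $(s_0,u_0)\mapsto(s_2,u_2)$ of the inverse magnetic billiard. Then, at points where $T_1$ and $T_2$ are differentiable and the expressions below are defined, $DT=\begin{pmatrix}\frac{\partial s_2}{\partial s_0}&\frac{\partial s_2}{\partial u_0}\\ \frac{\partial u_2}{\partial s_0}&\frac{\partial u_2}{\partial u_0}\end{pmatrix}$ with $$\frac{\partial s_2}{\partial s_0}=\frac{\kappa_0\ell_1\sin(2\chi-\theta_1)-\sin(\theta_0)\sin(2\chi-\theta_1)-\kappa_0\ell_2\cos(\chi)\sin(\theta_1)}{\sin(\theta_1)\sin(\theta_2)},$$ $$\frac{\partial s_2}{\partial u_0}=\frac{\ell_1\sin(2\chi-\theta_1)-\ell_2\cos(\chi)\sin(\theta_1)}{\sin(\theta_0)\sin(\theta_1)\sin(\theta_2)},$$ $$\frac{\partial u_2}{\partial s_0}=\frac{\kappa_2\sin(\theta_0)\sin(2\chi-\theta_1)}{\sin(\theta_1)}+\frac{2\sin(\chi)\sin(2\chi-\theta_1-\theta_2)(\kappa_0\ell_1-\sin(\theta_0))}{\ell_2\sin(\theta_1)}-\kappa_0\left(\sin(2\chi-\theta_2)+\frac{\kappa_2\ell_1\sin(2\chi-\theta_1)}{\sin(\theta_1)}-\kappa_2\ell_2\cos(\chi)\right),$$ $$\frac{\partial u_2}{\partial u_0}=\frac{\kappa_2\ell_2\cos(\chi)-\sin(2\chi-\theta_2)}{\sin(\theta_0)}+\frac{2\ell_1\sin(\chi)\sin(2\chi-\theta_1-\theta_2)-\kappa_2\ell_1\ell_2\sin(2\chi-\theta_1)}{\ell_2\sin(\theta_0)\sin(\theta_1)}.$$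 Furthermore, $\det(DT)=1$.
   Context: Inverse magnetic billiard: $\Omega\subset\mathbb{R}^2$ is a connected, bounded, strictly convex domain whose boundary $\partial\Omega$ is of class $C^k$, $k\ge3$, has length $L$ and is parametrized counterclockwise by arc length, $\Gamma(s)$, $s\in\mathbb{R}/L\mathbb{Z}$, with strictly positive curvature $\kappa(s)$. A particle moves at constant speed, along straight lines inside $\Omega$ and along counterclockwise circular arcs of radius $\mu>0$ (the Larmor radius) outside $\Omega$, its velocity being continuous across $\partial\Omega$. Starting from $P_0=\Gamma(s_0)$ with velocity pointing into $\Omega$, it follows the chord $P_0P_1$, exits $\Omega$ at $P_1=\Gamma(s_1)$, follows a counterclockwise arc $\gamma$ of radius $\mu$ outside $\Omega$, and re-enters $\Omega$ at the first return point $P_2=\Gamma(s_2)$. Let $\theta_i\in[0,\pi]$ be the angle between the positively oriented tangent to $\Gamma$ at $P_i$ and the velocity of the particle at $P_i$, and put $u_i=-\cos\theta_i$, $\kappa_i=\kappa(s_i)$, $\ell_1=|P_0P_1|$, $\ell_2=|P_1P_2|$. Let $\chi\in(0,\pi)$ be the angle measured counterclockwise from $\overrightarrow{P_0P_1}$ to $\overrightarrow{P_1P_2}$; the arc $\gamma$ subtends the angle $2\chi$ at its center and $\sin\chi=\ell_2/(2\mu)$. The maps are $T_1:(s_0,u_0)\mapsto(s_1,u_1)$ (interior chord), $T_2:(s_1,u_1)\mapsto(s_2,u_2)$ (exterior magnetic arc), and $T=T_2\circ T_1$, on the annulus $\mathbb{R}/L\mathbb{Z}\times[-1,1]$. *)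

theory Defs
  imports "HOL-Complex_Analysis.Complex_Analysis"
begin

text \<open>
  The Euclidean plane is identified with the type of complex numbers; rotation by an
  angle \<open>a\<close> is multiplication by \<open>cis a\<close>.
\<close>

definition strictly_convex :: "complex set \<Rightarrow> bool" where
  "strictly_convex S \<longleftrightarrow>
     (\<forall>x\<in>closure S. \<forall>y\<in>closure S. x \<noteq> y \<longrightarrow> open_segment x y \<subseteq> interior S)"

definition nth_vector_derivative :: "nat \<Rightarrow> (real \<Rightarrow> complex) \<Rightarrow> real \<Rightarrow> complex" where
  "nth_vector_derivative j f = ((\<lambda>g t. vector_derivative g (at t)) ^^ j) f"

definition C_k_curve :: "nat \<Rightarrow> (real \<Rightarrow> complex) \<Rightarrow> bool" where
  "C_k_curve k f \<longleftrightarrow>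
     (\<forall>j<k. \<forall>t. nth_vector_derivative j f differentiable (at t)) \<and>
     continuous_on UNIV (nth_vector_derivative k f)"

definition tangent :: "(real \<Rightarrow> complex) \<Rightarrow> real \<Rightarrow> complex" where
  "tangent \<Gamma> s = vector_derivative \<Gamma> (at s)"

text \<open>
  Signed curvature of a unit speed curve: the determinant of the first and second derivative,
  using \<open>Im (cnj v * w) = Re v * Im w - Im v * Re w\<close>.
\<close>

definition curvature :: "(real \<Rightarrow> complex) \<Rightarrow> real \<Rightarrow> real" where
  "curvature \<Gamma> s = Im (cnj (tangent \<Gamma> s) * vector_derivative (tangent \<Gamma>) (at s))"

text \<open>
  \<open>\<Gamma>\<close> is the \<open>L\<close>-periodic extension to the real line of a parametrization of the boundary
  by arc length.  The condition on winding numbers says that it runs counterclockwise.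
\<close>

definition billiard_table :: "complex set \<Rightarrow> nat \<Rightarrow> real \<Rightarrow> (real \<Rightarrow> complex) \<Rightarrow> bool" where
  "billiard_table \<Omega> k L \<Gamma> \<longleftrightarrow>
     open \<Omega> \<and> connected \<Omega> \<and> \<Omega> \<noteq> {} \<and> bounded \<Omega> \<and> strictly_convex \<Omega> \<and>
     0 < L \<and> (\<forall>s. \<Gamma> (s + L) = \<Gamma> s) \<and> inj_on \<Gamma> {0..<L} \<and> range \<Gamma> = frontier \<Omega> \<and>
     C_k_curve k \<Gamma> \<and> (\<forall>s. norm (tangent \<Gamma> s) = 1) \<and>
     (\<forall>z\<in>\<Omega>. winding_number (\<lambda>t. \<Gamma> (L * t)) z = 1) \<and>
     (\<forall>s. 0 < curvature \<Gamma> s)"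

text \<open>The unoriented angle between two nonzero vectors, in \<open>[0, \<pi>]\<close>.\<close>

definition vec_angle :: "complex \<Rightarrow> complex \<Rightarrow> real" where
  "vec_angle v w = arccos ((v \<bullet> w) / (norm v * norm w))"

text \<open>
  A phase point is a vector \<open>(s, u)\<close>, where \<open>u = - cos \<theta>\<close> and \<open>\<theta>\<close> in \<open>[0, \<pi>]\<close> is the angle
  between the tangent and the velocity.  Given \<open>(s, u)\<close>, the velocity is the tangent rotated by
  \<open>\<theta>\<close> counterclockwise if it points into the table, and clockwise if it points out of it.
  The speed is normalized to 1.
\<close>

definition velocity_in :: "(real \<Rightarrow> complex) \<Rightarrow> real ^ 2 \<Rightarrow> complex" where
  "velocity_in \<Gamma> p = tangent \<Gamma> (p $ 1) * cis (arccos (- (p $ 2)))"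

definition velocity_out :: "(real \<Rightarrow> complex) \<Rightarrow> real ^ 2 \<Rightarrow> complex" where
  "velocity_out \<Gamma> p = tangent \<Gamma> (p $ 1) * cis (- arccos (- (p $ 2)))"

text \<open>
  The maps below are lifts to the universal cover of the annulus \<open>\<real>/L\<int> \<times> [-1, 1]\<close>.  The end point
  of a chord or arc is different from its starting point, so it has exactly one parameter in the
  open interval of length \<open>L\<close> following that of the starting point; this choice depends
  continuously on the two points, so that the lifts and the maps on the annulus have the same
  derivatives.
\<close>

definition chord_step :: "complex set \<Rightarrow> real \<Rightarrow> (real \<Rightarrow> complex) \<Rightarrow> real ^ 2 \<Rightarrow> real ^ 2 \<Rightarrow> bool" where
  "chord_step \<Omega> L \<Gamma> p q \<longleftrightarrow>
     p $ 1 < q $ 1 \<and> q $ 1 < p $ 1 + L \<and>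
     (\<exists>l>0. \<Gamma> (q $ 1) = \<Gamma> (p $ 1) + of_real l * velocity_in \<Gamma> p) \<and>
     open_segment (\<Gamma> (p $ 1)) (\<Gamma> (q $ 1)) \<subseteq> \<Omega> \<and>
     q $ 2 = - cos (vec_angle (tangent \<Gamma> (q $ 1)) (velocity_in \<Gamma> p))"

text \<open>
  The counterclockwise circle of radius \<open>\<mu>\<close> through \<open>P\<close> with unit velocity \<open>v\<close> there,
  parametrized by the angle \<open>a\<close> swept out at the center \<open>P + \<mu> \<i> v\<close>; the velocity after the
  angle \<open>a\<close> is \<open>v * cis a\<close>.
\<close>

definition larmor_arc :: "real \<Rightarrow> complex \<Rightarrow> complex \<Rightarrow> real \<Rightarrow> complex" where
  "larmor_arc \<mu> P v a = P + of_real \<mu> * \<i> * v - of_real \<mu> * \<i> * v * cis a"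

definition arc_step ::
  "complex set \<Rightarrow> real \<Rightarrow> (real \<Rightarrow> complex) \<Rightarrow> real \<Rightarrow> real ^ 2 \<Rightarrow> real ^ 2 \<Rightarrow> bool" where
  "arc_step \<Omega> L \<Gamma> \<mu> p q \<longleftrightarrow>
     p $ 1 < q $ 1 \<and> q $ 1 < p $ 1 + L \<and>
     (\<exists>a. 0 < a \<and> a < 2 * pi \<and>
        \<Gamma> (q $ 1) = larmor_arc \<mu> (\<Gamma> (p $ 1)) (velocity_out \<Gamma> p) a \<and>
        (\<forall>b. 0 < b \<and> b < a \<longrightarrow>
           larmor_arc \<mu> (\<Gamma> (p $ 1)) (velocity_out \<Gamma> p) b \<notin> closure \<Omega>) \<and>
        q $ 2 = - cos (vec_angle (tangent \<Gamma> (q $ 1)) (velocity_out \<Gamma> p * cis a)))"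

definition chord_map :: "complex set \<Rightarrow> real \<Rightarrow> (real \<Rightarrow> complex) \<Rightarrow> real ^ 2 \<Rightarrow> real ^ 2" where
  "chord_map \<Omega> L \<Gamma> p = (THE q. chord_step \<Omega> L \<Gamma> p q)"

definition arc_map ::
  "complex set \<Rightarrow> real \<Rightarrow> (real \<Rightarrow> complex) \<Rightarrow> real \<Rightarrow> real ^ 2 \<Rightarrow> real ^ 2" where
  "arc_map \<Omega> L \<Gamma> \<mu> p = (THE q. arc_step \<Omega> L \<Gamma> \<mu> p q)"

definition return_map ::
  "complex set \<Rightarrow> real \<Rightarrow> (real \<Rightarrow> complex) \<Rightarrow> real \<Rightarrow> real ^ 2 \<Rightarrow> real ^ 2" where
  "return_map \<Omega> L \<Gamma> \<mu> = arc_map \<Omega> L \<Gamma> \<mu> \<circ> chord_map \<Omega> L \<Gamma>"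

text \<open>The angle in \<open>[0, 2\<pi>)\<close> measured counterclockwise from \<open>v\<close> to \<open>w\<close>.\<close>

definition ccw_angle :: "complex \<Rightarrow> complex \<Rightarrow> real" where
  "ccw_angle v w = Arg2pi (w / v)"

end

theory Submission
  imports Defs
begin

text \<open>
  The direction of flight is the right coordinate.  Let \<open>\<phi>\<close> be the polar angle of the velocity along
  the chord \<open>P\<^sub>0 P\<^sub>1\<close>.  Since \<open>P\<^sub>1\<close> is both the end of the chord and the start of the arc, the same
  infinitesimal rotation can be computed at either end,
  \<open>d\<phi> = \<kappa>\<^sub>0 ds\<^sub>0 + du\<^sub>0 / sin \<theta>\<^sub>0 = \<kappa>\<^sub>1 ds\<^sub>1 - du\<^sub>1 / sin \<theta>\<^sub>1\<close>,
  so in the pair \<open>(ds\<^sub>1, d\<phi>)\<close> the curvature at \<open>P\<^sub>1\<close> disappears.  Two constraints determine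
  everything else: \<open>P\<^sub>1\<close> stays on the line of flight from \<open>P\<^sub>0\<close>, which gives
  \<open>ds\<^sub>1 = (l\<^sub>1 d\<phi> - sin \<theta>\<^sub>0 ds\<^sub>0) / sin \<theta>\<^sub>1\<close> (\<open>chord_map_derivative\<close>), and \<open>P\<^sub>2\<close> stays on the Larmor
  circle, whose center is \<open>P\<^sub>1\<close> displaced by \<open>\<mu>\<close> perpendicularly to the velocity
  (\<open>arc_map_derivative\<close>).  The components \<open>u\<^sub>1\<close> and \<open>u\<^sub>2\<close> are minus the inner products of the tangent
  with the velocity and are differentiated as such.  Substituting
  \<open>l\<^sub>2 = 2 \<mu> sin \<chi>\<close> gives the four entries.

  In these coordinates the determinant is a product of two factors: the chord gives
  \<open>ds\<^sub>0 \<and> du\<^sub>0 = - sin \<theta>\<^sub>1 ds\<^sub>1 \<and> d\<phi>\<close>, and the arc gives \<open>ds\<^sub>2 \<and> du\<^sub>2 = - sin \<theta>\<^sub>1 ds\<^sub>1 \<and> d\<phi>\<close>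
  (\<open>det_from_transverse_area\<close>).

  Differentiability of the two maps is useful only together with the equations that define them,
  at all nearby phase points.  Each map is a definite description, so this needs existence and
  uniqueness of the chord and of the arc for every \<open>u\<close> in \<open>(-1, 1)\<close>.  The geometric input is that a
  supporting line of \<open>\<Omega>\<close> at \<open>\<Gamma> s\<close> is the tangent line, with \<open>\<Omega>\<close> on its left because the curvature is
  positive (\<open>support_functional_normal\<close>); consequently any curve that starts on the boundary with
  velocity strictly to the left of the tangent enters \<open>\<Omega>\<close> (\<open>inward_curve_enters_\<Omega>\<close>).  A chord exists
  since its ray enters \<open>\<Omega>\<close> and \<open>\<Omega>\<close> is bounded.  An arc exists since the Larmor circle, which starts
  outside, arrives back at its starting point from inside \<open>\<Omega>\<close>, so that it must have met the closure
  of \<open>\<Omega>\<close> before.  The same two facts decide on which side of the tangent the velocity points when the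
  particle reaches the boundary, which the angle \<open>\<theta>\<close> alone does not tell.
\<close>

(* Keep the dollar sign for components of vectors only. *)
no_notation fps_nth (infixl "$" 75)

section \<open>Plane vectors, critical points and Larmor arcs\<close>

lemma inner_eq_Re_cnj_mult: "z \<bullet> w = Re (cnj z * w)"
  by (simp add: inner_complex_def)

lemma inner_normal_eq_Im: "(\<i> * z) \<bullet> w = Im (cnj z * w)"
  by (simp add: inner_complex_def)

text \<open>
  The derivative is strictly positive just to the right of the critical point, so the function
  increases there.
\<close>

lemma no_max_at_positive_second_derivative:
  fixes f f' :: "real \<Rightarrow> real"
  assumes f: "\<And>t. (f has_real_derivative f' t) (at t)"
    and f': "(f' has_real_derivative c) (at s)"
    and crit: "f' s = 0" and "c > 0"
  shows "\<exists>t. f s < f t"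
proof -
  obtain d where d: "d > 0" "\<And>h. h > 0 \<Longrightarrow> h < d \<Longrightarrow> f' s < f' (s + h)"
    using DERIV_pos_inc_right[OF f' \<open>c > 0\<close>] by blast
  obtain z where z: "s < z" "z < s + d/2" "f (s + d/2) - f s = (s + d/2 - s) * f' z"
    using MVT2[of s "s + d/2" f f'] f d(1) by auto
  have "f' z > 0"
    using d(2)[of "z - s"] z d(1) crit by simp
  then have "f s < f (s + d/2)"
    using z(3) mult_pos_pos[OF d(1)] by fastforce
  then show ?thesis by blast
qed

text \<open>
  An arc that sweeps out the angle \<open>a\<close> at the center has a chord of length \<open>2 \<mu> sin (a/2)\<close>, turned by
  \<open>a/2\<close> against the initial velocity.  This is where the half angle \<open>\<chi> = a/2\<close> comes from.
\<close>

lemma larmor_arc_chord: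
  "larmor_arc \<mu> P v a = P + of_real (2 * \<mu> * sin (a/2)) * (v * cis (a/2))"
proof -
  have "cis a = cis (a/2) * cis (a/2)"
    by (simp add: cis_mult)
  moreover have "1 = cis (a/2) * cis (- (a/2))"
    by (simp add: cis_mult)
  ultimately have "1 - cis a = cis (a/2) * (cis (- (a/2)) - cis (a/2))"
    by (simp add: algebra_simps)
  also have "cis (- (a/2)) - cis (a/2) = - 2 * \<i> * of_real (sin (a/2))"
    by (simp add: complex_eq_iff)
  finally have *: "1 - cis a = - 2 * \<i> * of_real (sin (a/2)) * cis (a/2)"
    by (simp add: algebra_simps)
  have "larmor_arc \<mu> P v a = P + of_real \<mu> * \<i> * v * (1 - cis a)"
    by (simp add: larmor_arc_def algebra_simps)
  then show ?thesis
    unfolding * by (simp add: algebra_simps)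
qed

lemma larmor_arc_has_vector_derivative:
  "(larmor_arc \<mu> P v has_vector_derivative of_real \<mu> * (v * cis a)) (at a)"
proof -
  have "(cis has_vector_derivative \<i> * cis a) (at a)"
    unfolding has_vector_derivative_def by (auto intro!: derivative_eq_intros)
  then have "((\<lambda>a. P + of_real \<mu> * \<i> * v - of_real \<mu> * \<i> * v * cis a)
      has_vector_derivative (0 - of_real \<mu> * \<i> * v * (\<i> * cis a))) (at a)"
    by (intro has_vector_derivative_diff has_vector_derivative_const has_vector_derivative_mult_right)
  then show ?thesis
    by (simp add: larmor_arc_def[abs_def] algebra_simps)
qed

section \<open>The boundary curve and the convex region it bounds\<close>

text \<open>
  The tangent of the boundary has a derivative, so that its curvature is defined in the proper sense.
\<close>

locale smooth_table =
  fixes \<Omega> :: "complex set" and k :: nat and L :: real and \<Gamma> :: "real \<Rightarrow> complex"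
  assumes table: "billiard_table \<Omega> k L \<Gamma>" and two_le_k: "2 \<le> k"
begin

abbreviation "T \<equiv> tangent \<Gamma>"
abbreviation "\<kappa> \<equiv> curvature \<Gamma>"

lemma L_pos: "0 < L" and \<Gamma>_shift: "\<Gamma> (s + L) = \<Gamma> s" and \<Gamma>_inj: "inj_on \<Gamma> {0..<L}"
  and \<Gamma>_range: "range \<Gamma> = frontier \<Omega>"
  and \<Omega>_open: "open \<Omega>" and \<Omega>_ne: "\<Omega> \<noteq> {}" and \<Omega>_bounded: "bounded \<Omega>"
  and norm_T: "norm (T s) = 1" and curvature_pos: "0 < \<kappa> s"
  using table by (auto simp: billiard_table_def)

lemma \<Gamma>_deriv: "(\<Gamma> has_vector_derivative T s) (at s)"
  and T_differentiable: "T differentiable (at s)"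
proof -
  have "\<And>j t. j < k \<Longrightarrow> nth_vector_derivative j \<Gamma> differentiable (at t)"
    using table by (auto simp: billiard_table_def C_k_curve_def)
  from this[of 0 s] this[of 1 s] two_le_k
  show "(\<Gamma> has_vector_derivative T s) (at s)" "T differentiable (at s)"
    by (auto simp: nth_vector_derivative_def tangent_def[abs_def] vector_derivative_works[symmetric])
qed

lemma cnj_T_mult_T: "cnj (T s) * T s = 1"
  using complex_norm_square[of "T s"] norm_T[of s] by (simp add: mult.commute)

text \<open>
  Frenet equation: a unit vector changes only perpendicularly to itself.
\<close>

lemma T_deriv: "(T has_vector_derivative of_real (\<kappa> s) * (\<i> * T s)) (at s)"
proof -
  define D where "D = vector_derivative T (at s)"
  have D: "(T has_vector_derivative D) (at s)"
    using T_differentiable unfolding D_def by (simp add: vector_derivative_works[symmetric])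
  have "((\<lambda>t. T t \<bullet> T t) has_derivative (\<lambda>h. T s \<bullet> (h *\<^sub>R D) + (h *\<^sub>R D) \<bullet> T s)) (at s)"
    using D unfolding has_vector_derivative_def by (intro has_derivative_inner)
  moreover have "(\<lambda>t. T t \<bullet> T t) = (\<lambda>t. 1)"
    by (simp add: dot_square_norm norm_T)
  ultimately have "(\<lambda>h. T s \<bullet> (h *\<^sub>R D) + (h *\<^sub>R D) \<bullet> T s) = (\<lambda>h. 0)"
    using has_derivative_const has_derivative_unique by metis
  then have "T s \<bullet> D = 0"
    by (auto dest: fun_cong[of _ _ 1] simp: inner_commute)
  then have "cnj (T s) * D = \<i> * of_real (\<kappa> s)"
    by (simp add: complex_eq_iff inner_complex_def curvature_def D_def)
  then have "T s * (cnj (T s) * D) = of_real (\<kappa> s) * (\<i> * T s)"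
    by simp
  also have "T s * (cnj (T s) * D) = D"
    using cnj_T_mult_T[of s] by (metis mult.assoc mult.commute mult_1)
  finally show ?thesis using D by simp
qed

lemma open_segment_in_\<Omega>:
  "x \<in> closure \<Omega> \<Longrightarrow> y \<in> closure \<Omega> \<Longrightarrow> x \<noteq> y \<Longrightarrow> open_segment x y \<subseteq> \<Omega>"
  using table interior_open[OF \<Omega>_open] by (auto simp: billiard_table_def strictly_convex_def)

lemma convex_\<Omega>: "convex \<Omega>"
proof -
  have "closed_segment x y \<subseteq> \<Omega>" if "x \<in> \<Omega>" "y \<in> \<Omega>" for x y
    using open_segment_in_\<Omega>[of x y] that closure_subset[of \<Omega>]
    by (cases "x = y") (auto simp: open_segment_def)
  then show ?thesis by (simp add: convex_contains_segment)
qed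

lemma \<Gamma>_frontier: "\<Gamma> s \<in> frontier \<Omega>"
  using \<Gamma>_range by blast

lemma \<Gamma>_not_in_\<Omega>: "\<Gamma> s \<notin> \<Omega>"
  using \<Gamma>_frontier[of s] \<Omega>_open by (auto simp: frontier_def interior_open)

lemma \<Gamma>_closure: "\<Gamma> s \<in> closure \<Omega>"
  using \<Gamma>_frontier[of s] by (auto simp: frontier_def)

lemma \<Gamma>_shift_int: "\<Gamma> (s + of_int n * L) = \<Gamma> s"
proof -
  have nat: "\<Gamma> (t + real m * L) = \<Gamma> t" for t m
  proof (induction m)
    case (Suc m)
    then show ?case using \<Gamma>_shift[of "t + real m * L"] by (simp add: algebra_simps)
  qed simp
  show ?thesis
  proof (cases "n \<ge> 0")
    case True
    then show ?thesis using nat[of s "nat n"] by simp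
  next
    case False
    then show ?thesis using nat[of "s + of_int n * L" "nat (- n)"] by simp
  qed
qed

lemma \<Gamma>_frac: "\<Gamma> (s + L * frac ((t - s) / L)) = \<Gamma> t"
proof -
  have "s + L * frac ((t - s) / L) = t + of_int (- \<lfloor>(t - s) / L\<rfloor>) * L"
    using L_pos by (simp add: frac_def right_diff_distrib[of L "(t - s) / L"])
  then show ?thesis by (simp only: \<Gamma>_shift_int)
qed

text \<open>
  Injectivity on one period, which starts at \<open>0\<close>, is carried to the period starting at \<open>s\<close>:
  both parameters are reduced modulo \<open>L\<close>, and they differ by a multiple of \<open>L\<close> smaller than \<open>L\<close>.
\<close>

lemma ex1_parameter:
  assumes "P \<in> frontier \<Omega>" "P \<noteq> \<Gamma> s"
  shows "\<exists>!t. s < t \<and> t < s + L \<and> \<Gamma> t = P"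
proof -
  obtain r where r: "\<Gamma> r = P" using assms(1) \<Gamma>_range by (metis imageE)
  define t where "t = s + L * frac ((r - s) / L)"
  have t: "\<Gamma> t = P" unfolding t_def \<Gamma>_frac r ..
  have "s \<le> t" "t < s + L"
    using L_pos by (auto simp: t_def frac_ge_0 frac_lt_1)
  moreover have "t \<noteq> s" using t assms(2) by auto
  moreover have "t = t'" if t': "s < t'" "t' < s + L" "\<Gamma> t' = P" for t'
  proof -
    have "\<Gamma> (0 + L * frac ((t - 0) / L)) = \<Gamma> (0 + L * frac ((t' - 0) / L))"
      unfolding \<Gamma>_frac using t t' by simp
    then have "L * frac (t / L) = L * frac (t' / L)"
      using L_pos by (intro inj_onD[OF \<Gamma>_inj]) (auto simp: frac_ge_0 frac_lt_1)
    then have "t / L - t' / L = of_int (\<lfloor>t / L\<rfloor> - \<lfloor>t' / L\<rfloor>)"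
      using L_pos by (simp add: frac_def)
    moreover have "\<bar>t / L - t' / L\<bar> < 1"
      using that L_pos \<open>s \<le> t\<close> \<open>t < s + L\<close> by (simp add: abs_less_iff field_simps)
    ultimately have "\<bar>\<lfloor>t / L\<rfloor> - \<lfloor>t' / L\<rfloor>\<bar> < 1" by linarith
    then have "t / L = t' / L"
      using \<open>t / L - t' / L = _\<close> by simp
    then show ?thesis using L_pos by simp
  qed
  ultimately show ?thesis
    using t by (intro ex1I[of _ t]) auto
qed

text \<open>
  Along the boundary curve a linear functional that is maximal on \<open>\<Omega>\<close> at \<open>\<Gamma> s\<close> has a maximum at the
  parameter \<open>s\<close>.  The first derivative there forces the functional to be a multiple of the normal
  \<open>\<i> T\<close>, and the second one, which is that multiple times the positive curvature, forces the sign.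
  So the counterclockwise orientation enters through the sign of the curvature.
\<close>

lemma support_functional_normal:
  assumes a: "a \<noteq> 0" and le: "\<And>z. z \<in> \<Omega> \<Longrightarrow> a \<bullet> z \<le> a \<bullet> \<Gamma> s"
  obtains c where "c < 0" "a = of_real c * (\<i> * T s)"
proof -
  have le': "a \<bullet> z \<le> a \<bullet> \<Gamma> s" if "z \<in> closure \<Omega>" for z
    using closure_minimal[of \<Omega> "{z. a \<bullet> z \<le> a \<bullet> \<Gamma> s}"] le that closed_halfspace_le by auto
  have f: "((\<lambda>t. a \<bullet> \<Gamma> t) has_real_derivative a \<bullet> T t) (at t)" for t
    using has_derivative_inner_right[OF \<Gamma>_deriv[of t, unfolded has_vector_derivative_def], of a]
    by (simp add: has_field_derivative_def mult_commute_abs)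
  have f': "((\<lambda>t. a \<bullet> T t) has_real_derivative \<kappa> s * (a \<bullet> (\<i> * T s))) (at s)"
    using has_derivative_inner_right[OF T_deriv[of s, unfolded has_vector_derivative_def], of a]
    by (simp add: has_field_derivative_def mult_commute_abs mult.assoc flip: scaleR_conv_of_real)
  have "a \<bullet> T s = 0"
    using DERIV_local_max[OF f zero_less_one] le' \<Gamma>_closure by blast
  then have "Re (cnj (T s) * a) = 0"
    by (simp add: inner_complex_def algebra_simps)
  then have "cnj (T s) * a = of_real (Im (cnj (T s) * a)) * \<i>"
    by (simp add: complex_eq_iff)
  then have "a = of_real (Im (cnj (T s) * a)) * (\<i> * T s)"
    using cnj_T_mult_T[of s] by (metis mult.assoc mult.commute mult_1)
  moreover have "\<not> a \<bullet> (\<i> * T s) > 0"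
  proof
    assume "a \<bullet> (\<i> * T s) > 0"
    then obtain t where "a \<bullet> \<Gamma> s < a \<bullet> \<Gamma> t"
      using no_max_at_positive_second_derivative[OF f f'] \<open>a \<bullet> T s = 0\<close> curvature_pos by force
    then show False using le'[OF \<Gamma>_closure[of t]] by simp
  qed
  then have "Im (cnj (T s) * a) \<le> 0"
    by (simp add: inner_commute[of a] inner_normal_eq_Im)
  ultimately show ?thesis
    using a that by (metis le_less mult_zero_left of_real_0)
qed

lemma closure_left_of_tangent:
  assumes "z \<in> closure \<Omega>" shows "0 \<le> Im (cnj (T s) * (z - \<Gamma> s))"
proof -
  obtain a b where ab: "a \<noteq> 0" "\<forall>x\<in>\<Omega>. a \<bullet> x \<le> b" "\<forall>x\<in>{\<Gamma> s}. b \<le> a \<bullet> x"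
    using separating_hyperplane_sets[of \<Omega> "{\<Gamma> s}"] convex_\<Omega> \<Omega>_ne \<Gamma>_not_in_\<Omega> by auto
  then have le: "\<And>z. z \<in> \<Omega> \<Longrightarrow> a \<bullet> z \<le> a \<bullet> \<Gamma> s" by force
  then obtain c where c: "c < 0" "a = of_real c * (\<i> * T s)"
    using support_functional_normal[OF ab(1)] by metis
  have "a \<bullet> z \<le> a \<bullet> \<Gamma> s"
    using closure_minimal[of \<Omega> "{z. a \<bullet> z \<le> a \<bullet> \<Gamma> s}"] le assms closed_halfspace_le by auto
  then have "c * ((\<i> * T s) \<bullet> (z - \<Gamma> s)) \<le> 0"
    unfolding c(2) scaleR_conv_of_real[symmetric] by (simp add: inner_diff_right algebra_simps)
  then show ?thesis
    using c(1) by (simp add: inner_normal_eq_Im mult_le_0_iff)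
qed

text \<open>
  A ray that misses \<open>\<Omega>\<close> could be separated from it.  The separating functional would be a supporting
  one at \<open>\<Gamma> s\<close>, hence a negative multiple of the normal, and would decrease without bound along the ray.
\<close>

lemma inward_ray_meets_\<Omega>:
  assumes "0 < Im (cnj (T s) * v)"
  obtains t where "0 < t" "\<Gamma> s + of_real t * v \<in> \<Omega>"
proof -
  define R where "R = (\<lambda>t. \<Gamma> s + t *\<^sub>R v) ` {0..}"
  have "convex R"
  proof -
    have "R = (\<lambda>x. \<Gamma> s + x) ` ((\<lambda>t. t *\<^sub>R v) ` {0..})"
      unfolding R_def image_image ..
    then show ?thesis
      by (auto intro!: convex_translation convex_linear_image linear_scaleR_left)
  qed
  have "R \<inter> \<Omega> \<noteq> {}"
  proof
    assume "R \<inter> \<Omega> = {}"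
    then obtain a b where ab: "a \<noteq> 0" "\<forall>x\<in>\<Omega>. a \<bullet> x \<le> b" "\<forall>x\<in>R. b \<le> a \<bullet> x"
      using separating_hyperplane_sets[of \<Omega> R] convex_\<Omega> \<Omega>_ne \<open>convex R\<close>
      by (auto simp: R_def Int_commute)
    have "\<Gamma> s \<in> R" unfolding R_def by (rule image_eqI[of _ _ 0]) auto
    then have "\<And>z. z \<in> \<Omega> \<Longrightarrow> a \<bullet> z \<le> a \<bullet> \<Gamma> s" using ab by force
    then obtain c where c: "c < 0" "a = of_real c * (\<i> * T s)"
      using support_functional_normal[OF ab(1)] by metis
    then have av: "a \<bullet> v < 0"
      using assms unfolding c(2) scaleR_conv_of_real[symmetric]
      by (simp add: inner_normal_eq_Im mult_neg_pos)
    \<comment> \<open>Far enough along the ray for the functional to fall below the separating value \<open>b\<close>.\<close>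
    define t where "t = (\<bar>b - a \<bullet> \<Gamma> s\<bar> + 1) / - (a \<bullet> v)"
    have "t \<ge> 0" using av by (simp add: t_def divide_le_0_iff)
    then have "b \<le> a \<bullet> (\<Gamma> s + t *\<^sub>R v)" using ab(3) by (auto simp: R_def)
    moreover have "t * (a \<bullet> v) = - (\<bar>b - a \<bullet> \<Gamma> s\<bar> + 1)"
      using av by (simp add: t_def)
    ultimately show False by (simp add: inner_add_right)
  qed
  then obtain t where t: "t \<ge> 0" "\<Gamma> s + t *\<^sub>R v \<in> \<Omega>" by (auto simp: R_def)
  moreover have "t \<noteq> 0" using t \<Gamma>_not_in_\<Omega> by auto
  ultimately show ?thesis
    using that[of t] by (simp add: scaleR_conv_of_real)
qed

text \<open>
  Seen from \<open>\<Gamma> s\<close>, the point \<open>c t\<close> lies in the direction of a difference quotient close to \<open>v\<close>.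
  Going a fixed distance \<open>r\<close> in that direction leads into the open set \<open>\<Omega>\<close>, and for \<open>t < r\<close> the point
  \<open>c t\<close> lies on the open segment from \<open>\<Gamma> s\<close> to there, inside by convexity.
\<close>

lemma inward_curve_enters_\<Omega>:
  assumes c: "(c has_vector_derivative v) (at 0)" "c 0 = \<Gamma> s"
    and v: "0 < Im (cnj (T s) * v)"
  shows "\<forall>\<^sub>F t in at_right 0. c t \<in> \<Omega>"
proof -
  obtain r where r: "0 < r" "\<Gamma> s + of_real r * v \<in> \<Omega>"
    using inward_ray_meets_\<Omega>[OF v] by blast
  define w where "w t = (1 / t) *\<^sub>R (c t - \<Gamma> s)" for t
  have "((\<lambda>t. norm (w t - v)) \<longlongrightarrow> 0) (at 0)"
  proof (rule Lim_transform_eventually)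
    show "((\<lambda>t. norm (c t - c 0 - (t - 0) *\<^sub>R v) / norm (t - 0)) \<longlongrightarrow> 0) (at 0)"
      using c(1) by (simp add: has_vector_derivative_def has_derivative_iff_norm)
    have "norm (c t - c 0 - (t - 0) *\<^sub>R v) / norm (t - 0) = norm (w t - v)" if "t \<noteq> 0" for t
    proof -
      have "w t - v = (1 / t) *\<^sub>R (c t - c 0 - (t - 0) *\<^sub>R v)"
        using that by (simp add: w_def c(2) algebra_simps)
      then have "norm (w t - v) = \<bar>1 / t\<bar> * norm (c t - c 0 - (t - 0) *\<^sub>R v)"
        by (simp only: norm_scaleR)
      then show ?thesis by simp
    qed
    then show "\<forall>\<^sub>F t in at 0. norm (c t - c 0 - (t - 0) *\<^sub>R v) / norm (t - 0) = norm (w t - v)"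
      by (simp add: eventually_at_filter)
  qed
  then have "(w \<longlongrightarrow> v) (at 0)"
    by (simp add: tendsto_norm_zero_iff LIM_zero_iff)
  then have "(w \<longlongrightarrow> v) (at_right 0)"
    by (rule filterlim_mono) (auto simp: at_le)
  then have "((\<lambda>t. \<Gamma> s + of_real r * w t) \<longlongrightarrow> \<Gamma> s + of_real r * v) (at_right 0)"
    by (intro tendsto_intros)
  then have "\<forall>\<^sub>F t in at_right 0. \<Gamma> s + of_real r * w t \<in> \<Omega>"
    using r \<Omega>_open by (auto simp: tendsto_def)
  moreover have "\<forall>\<^sub>F t in at_right 0. t < r" "\<forall>\<^sub>F t in at_right (0::real). 0 < t"
    using r eventually_at_right_less by (auto simp: eventually_at_right_field)
  ultimately show ?thesis
  proof eventually_elim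
    case (elim t)
    have eq: "c t = \<Gamma> s + (t / r) *\<^sub>R (\<Gamma> s + of_real r * w t - \<Gamma> s)"
      using elim r(1) by (simp add: w_def scaleR_conv_of_real)
    have "c t \<in> open_segment (\<Gamma> s) (\<Gamma> s + of_real r * w t)"
      using elim r(1) \<Gamma>_not_in_\<Omega>[of s] unfolding eq in_segment
      by (intro conjI exI[of _ "t / r"]) (auto simp: algebra_simps)
    then show ?case
      using open_segment_in_\<Omega>[of "\<Gamma> s" "\<Gamma> s + of_real r * w t"] \<Gamma>_closure \<Gamma>_not_in_\<Omega>[of s]
        closure_subset[of \<Omega>] elim by (metis subsetD)
  qed
qed

end

section \<open>Both maps are given by existing and unique chords and arcs\<close>

text \<open>
  The angle to the tangent is known only up to sign from its cosine; the sign is recovered from the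
  side of the tangent on which the vector lies.
\<close>

lemma unit_eq_cis_arccos:
  assumes "norm w = 1" "0 \<le> Im w"
  shows "w = cis (arccos (Re w))"
proof -
  have r: "\<bar>Re w\<bar> \<le> 1" using abs_Re_le_cmod[of w] assms(1) by simp
  have "(Re w)\<^sup>2 + (Im w)\<^sup>2 = 1"
    using assms(1) by (simp add: norm_complex_def)
  then have "sqrt (1 - (Re w)\<^sup>2) = Im w"
    using assms(2) by (intro real_sqrt_unique) auto
  then show ?thesis
    using r by (simp add: complex_eq_iff sin_arccos_abs cos_arccos_abs)
qed

lemma cos_vec_angle_unit:
  assumes "norm v = 1" "norm w = 1"
  shows "cos (vec_angle v w) = Re (cnj v * w)"
proof -
  have "\<bar>v \<bullet> w\<bar> \<le> 1" using Cauchy_Schwarz_ineq2[of v w] assms by simp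
  then have "cos (vec_angle v w) = v \<bullet> w"
    using assms by (simp add: vec_angle_def cos_arccos_abs)
  then show ?thesis by (simp only: inner_eq_Re_cnj_mult)
qed

lemma sin_arccos_pos: "- 1 < x \<Longrightarrow> x < 1 \<Longrightarrow> 0 < sin (arccos x)"
  using arccos_lt_bounded[of x] by (intro sin_gt_zero) auto

context smooth_table
begin

lemma norm_velocity_in: "norm (velocity_in \<Gamma> p) = 1"
  and norm_velocity_out: "norm (velocity_out \<Gamma> p) = 1"
  by (simp_all add: velocity_in_def velocity_out_def norm_mult norm_T)

lemma cnj_T_mult_T_mult: "cnj (T s) * (T s * z) = z"
  by (simp add: cnj_T_mult_T flip: mult.assoc)

lemma T_mult_cnj_T_mult: "T s * (cnj (T s) * z) = z"
  using cnj_T_mult_T[of s] by (metis mult.assoc mult.commute mult_1)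

text \<open>
  The chord ends where the ray, after entering \<open>\<Omega>\<close>, first meets the frontier of this bounded set.
  It is unique by strict convexity: of two frontier points on the ray, the nearer one would lie on an
  open segment contained in \<open>\<Omega>\<close>.
\<close>

lemma chord_step_ex1:
  assumes "- 1 < p $ 2" "p $ 2 < 1"
  shows "\<exists>!q. chord_step \<Omega> L \<Gamma> p q"
proof -
  define s where "s = p $ 1"
  define v where "v = velocity_in \<Gamma> p"
  have "0 < Im (cnj (T s) * v)"
    using sin_arccos_pos[of "- (p $ 2)"] assms
    by (simp add: v_def velocity_in_def s_def cnj_T_mult_T_mult)
  then obtain t0 where t0: "0 < t0" "\<Gamma> s + of_real t0 * v \<in> \<Omega>"
    using inward_ray_meets_\<Omega> by blast
  have "v \<noteq> 0" using norm_velocity_in[of p] by (auto simp: v_def)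
  then obtain d where d: "0 < d" "\<Gamma> s + of_real t0 * v + d *\<^sub>R v \<in> frontier \<Omega>"
    using ray_to_frontier[OF \<Omega>_bounded, of "\<Gamma> s + of_real t0 * v" v] t0 \<Omega>_open
    by (auto simp: interior_open)
  define l where "l = t0 + d"
  define P where "P = \<Gamma> s + of_real l * v"
  have l: "l > 0" using t0 d by (simp add: l_def)
  then have P: "P \<in> frontier \<Omega>" "P \<noteq> \<Gamma> s"
    using d \<open>v \<noteq> 0\<close> by (simp_all add: P_def) (simp add: l_def scaleR_conv_of_real distrib_right add.assoc)
  obtain t where t: "s < t" "t < s + L" "\<Gamma> t = P"
    using ex1_parameter[OF P] by blast
  have "P \<in> closure \<Omega>" using P by (simp add: frontier_def)
  define q :: "real ^ 2" where "q = vector [t, - cos (vec_angle (T t) v)]"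
  have "chord_step \<Omega> L \<Gamma> p q"
    using t l open_segment_in_\<Omega>[OF \<Gamma>_closure \<open>P \<in> closure \<Omega>\<close>] P(2)
    by (auto simp: chord_step_def q_def v_def[symmetric] s_def[symmetric] P_def)
  moreover have "q' = q''"
    if q': "chord_step \<Omega> L \<Gamma> p q'" and q'': "chord_step \<Omega> L \<Gamma> p q''" for q' q''
  proof -
    have less: "\<not> l' < l''"
      if "0 < l'" "\<Gamma> r' = \<Gamma> s + of_real l' * v" "\<Gamma> r'' = \<Gamma> s + of_real l'' * v" for l' l'' r' r''
    proof
      assume "l' < l''"
      then have ne: "\<Gamma> s \<noteq> \<Gamma> r''" using that \<open>v \<noteq> 0\<close> by auto
      have "\<Gamma> r' = (1 - l' / l'') *\<^sub>R \<Gamma> s + (l' / l'') *\<^sub>R \<Gamma> r''"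
        using that \<open>l' < l''\<close> by (simp add: scaleR_conv_of_real algebra_simps)
      then have "\<Gamma> r' \<in> open_segment (\<Gamma> s) (\<Gamma> r'')"
        using ne that(1) \<open>l' < l''\<close> unfolding in_segment by (intro conjI exI[of _ "l' / l''"]) auto
      then show False
        using open_segment_in_\<Omega>[OF \<Gamma>_closure \<Gamma>_closure ne] \<Gamma>_not_in_\<Omega> by blast
    qed
    obtain l' l'' where l': "l' > 0" "\<Gamma> (q' $ 1) = \<Gamma> s + of_real l' * v"
      and l'': "l'' > 0" "\<Gamma> (q'' $ 1) = \<Gamma> s + of_real l'' * v"
      using q' q'' unfolding chord_step_def s_def v_def by blast
    have "l' = l''" using less[of l' _ _ l''] less[of l'' _ _ l'] l' l'' by (metis linorder_neqE)
    then have eq: "\<Gamma> (q'' $ 1) = \<Gamma> (q' $ 1)" using l' l'' by simp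
    have "\<Gamma> (q' $ 1) \<noteq> \<Gamma> s" using l' \<open>v \<noteq> 0\<close> by simp
    then have "q' $ 1 = q'' $ 1"
      using ex1_parameter[OF \<Gamma>_frontier, of "q' $ 1" s] eq q' q''
      unfolding chord_step_def s_def by metis
    then show ?thesis
      using q' q'' by (simp add: chord_step_def vec_eq_iff forall_2)
  qed
  ultimately show ?thesis by blast
qed

lemma chord_step_chord_map:
  "- 1 < p $ 2 \<Longrightarrow> p $ 2 < 1 \<Longrightarrow> chord_step \<Omega> L \<Gamma> p (chord_map \<Omega> L \<Gamma> p)"
  unfolding chord_map_def by (rule theI'[OF chord_step_ex1])

lemma chord_step_u:
  "chord_step \<Omega> L \<Gamma> p q \<Longrightarrow> q $ 2 = - Re (cnj (T (q $ 1)) * velocity_in \<Gamma> p)"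
  by (simp add: chord_step_def cos_vec_angle_unit norm_T norm_velocity_in)

text \<open>
  At the end of the chord the starting point lies on the left of the tangent, so the velocity points
  to the right of it.  Thus the particle starts its arc with the velocity that it had along the chord.
\<close>

lemma chord_step_velocity:
  assumes "chord_step \<Omega> L \<Gamma> p q"
  shows "velocity_out \<Gamma> q = velocity_in \<Gamma> p"
proof -
  define w where "w = cnj (T (q $ 1)) * velocity_in \<Gamma> p"
  obtain l where l: "l > 0" "\<Gamma> (q $ 1) = \<Gamma> (p $ 1) + of_real l * velocity_in \<Gamma> p"
    using assms unfolding chord_step_def by blast
  have "0 \<le> Im (cnj (T (q $ 1)) * (\<Gamma> (p $ 1) - \<Gamma> (q $ 1)))"
    by (rule closure_left_of_tangent[OF \<Gamma>_closure])
  also have "cnj (T (q $ 1)) * (\<Gamma> (p $ 1) - \<Gamma> (q $ 1)) = of_real (- l) * w"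
    by (simp add: l w_def)
  finally have "Im w \<le> 0" using l(1) by (simp add: mult_le_0_iff)
  moreover have "norm w = 1" by (simp add: w_def norm_mult norm_T norm_velocity_in)
  ultimately have "cnj w = cis (arccos (Re w))"
    using unit_eq_cis_arccos[of "cnj w"] by simp
  then have "w = cis (- arccos (Re w))" by (metis cis_cnj complex_cnj_cnj)
  then show ?thesis
    using T_mult_cnj_T_mult chord_step_u[OF assms] by (metis velocity_out_def w_def minus_minus)
qed

text \<open>
  As long as \<open>a/2 < \<theta>\<close>, the chord of the arc, which has turned by \<open>a/2\<close>, still points to the right of
  the tangent, and \<open>\<Omega>\<close> lies on the left.
\<close>

lemma arc_starts_outside:
  assumes "\<mu> > 0" "0 < a" "a < 2 * arccos (- (p $ 2))" "-1 \<le> p $ 2" "p $ 2 \<le> 1"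
  shows "larmor_arc \<mu> (\<Gamma> (p $ 1)) (velocity_out \<Gamma> p) a \<notin> closure \<Omega>"
proof
  define \<theta> where "\<theta> = arccos (- (p $ 2))"
  assume "larmor_arc \<mu> (\<Gamma> (p $ 1)) (velocity_out \<Gamma> p) a \<in> closure \<Omega>"
  from closure_left_of_tangent[OF this, of "p $ 1"]
  have "0 \<le> Im (cnj (T (p $ 1)) * (of_real (2 * \<mu> * sin (a/2)) * (T (p $ 1) * cis (- \<theta>) * cis (a/2))))"
    by (simp add: larmor_arc_chord velocity_out_def \<theta>_def)
  also have "cnj (T (p $ 1)) * (of_real (2 * \<mu> * sin (a/2)) * (T (p $ 1) * cis (- \<theta>) * cis (a/2)))
     = of_real (2 * \<mu> * sin (a/2)) * (cnj (T (p $ 1)) * (T (p $ 1) * (cis (- \<theta>) * cis (a/2))))"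
    by (simp only: ac_simps)
  also have "\<dots> = of_real (2 * \<mu> * sin (a/2)) * cis (a/2 - \<theta>)"
    unfolding cnj_T_mult_T_mult by (simp add: cis_mult)
  finally have "0 \<le> (2 * \<mu> * sin (a/2)) * sin (a/2 - \<theta>)" by simp
  moreover have "\<theta> \<le> pi" using assms by (simp add: \<theta>_def arccos_ubound)
  then have "sin (a/2) > 0" "sin (a/2 - \<theta>) < 0"
    using assms sin_gt_zero[of "a/2"] sin_gt_zero[of "\<theta> - a/2"] sin_minus[of "\<theta> - a/2"]
    by (auto simp: \<theta>_def[symmetric])
  ultimately show False
    using mult_pos_neg[of "2 * \<mu> * sin (a/2)" "sin (a/2 - \<theta>)"] assms(1) by simp
qed

text \<open>
  An arc followed backwards in time, the form in which arrivals at the boundary are examined.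
\<close>

lemma reversed_arc_deriv:
  "((\<lambda>b. larmor_arc \<mu> P v (a - b)) has_vector_derivative - (of_real \<mu> * (v * cis a))) (at 0)"
proof -
  have "((\<lambda>b. a - b) has_vector_derivative - 1) (at 0)"
    by (auto intro!: derivative_eq_intros simp: has_vector_derivative_def)
  from vector_diff_chain_at[OF this] larmor_arc_has_vector_derivative[of \<mu> P v "a - 0"]
  show ?thesis by (simp add: o_def)
qed

text \<open>
  Followed backwards from the full turn \<open>2 \<pi>\<close>, the circle leaves \<open>\<Gamma> s\<close> with a velocity that points
  strictly inwards, so it passes through \<open>\<Omega>\<close> shortly before the full turn.  Since it starts outside the
  closure, there is a first angle at which it meets the closure, and it does so on the frontier.
\<close>

lemma arc_step_ex1:
  assumes "\<mu> > 0" "- 1 < p $ 2" "p $ 2 < 1"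
  shows "\<exists>!q. arc_step \<Omega> L \<Gamma> \<mu> p q"
proof -
  define s where "s = p $ 1"
  define v where "v = velocity_out \<Gamma> p"
  define \<theta> where "\<theta> = arccos (- (p $ 2))"
  define A where "A = larmor_arc \<mu> (\<Gamma> s) v"
  have \<theta>: "0 < \<theta>" "\<theta> < pi" using assms arccos_lt_bounded[of "- (p $ 2)"] by (auto simp: \<theta>_def)
  have cont: "continuous_on S A" for S
    unfolding A_def larmor_arc_def[abs_def] by (intro continuous_intros)
  have "Im (cnj (T s) * v) = - sin \<theta>"
    by (simp add: v_def velocity_out_def s_def cnj_T_mult_T_mult \<theta>_def)
  then have inward: "0 < Im (cnj (T s) * (- (of_real \<mu> * (v * cis (2 * pi)))))"
    using assms(1) sin_gt_zero[OF \<theta>] by (simp add: algebra_simps)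
  have "A (2 * pi) = \<Gamma> s" by (simp add: A_def larmor_arc_def)
  then have "\<forall>\<^sub>F b in at_right 0. A (2 * pi - b) \<in> \<Omega>"
    using inward_curve_enters_\<Omega>[OF reversed_arc_deriv _ inward, of "\<Gamma> s"] by (simp add: A_def)
  moreover have "\<forall>\<^sub>F b in at_right 0. b < pi" "\<forall>\<^sub>F b in at_right (0::real). 0 < b"
    using eventually_at_right_less by (auto simp: eventually_at_right_field intro: exI[of _ pi])
  ultimately have "\<forall>\<^sub>F b in at_right (0::real). 0 < b \<and> b < pi \<and> A (2 * pi - b) \<in> \<Omega>"
    by eventually_elim auto
  then obtain b where b: "0 < b" "b < pi" "A (2 * pi - b) \<in> \<Omega>"
    using eventually_happens[of _ "at_right (0::real)"] by auto
  \<comment> \<open>The lower bound \<open>\<theta>\<close> excludes the starting point and costs nothing, as no angle below \<open>2 \<theta>\<close> is a return.\<close>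
  define S where "S = {\<theta>..2 * pi - b} \<inter> A -` closure \<Omega>"
  have "compact S"
    unfolding S_def
    using closed_vimage[OF closed_closure cont[of UNIV]]
    by (intro compact_Int_closed compact_Icc)
  moreover have "2 * pi - b \<in> S"
    using b \<theta> closure_subset[of \<Omega>] by (auto simp: S_def)
  ultimately obtain a where a: "a \<in> S" "\<And>c. c \<in> S \<Longrightarrow> a \<le> c"
    using compact_attains_inf[of S] by blast
  have before: "A c \<notin> closure \<Omega>" if "0 < c" "c < a" for c
  proof (cases "c < \<theta>")
    case True
    then show ?thesis
      using arc_starts_outside[of \<mu> c p] assms that \<theta> by (simp add: A_def v_def s_def \<theta>_def)
  next
    case False
    show ?thesis
    proof
      assume "A c \<in> closure \<Omega>"
      then have "c \<in> S" using False a(1) that by (simp add: S_def)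
      then show False using a(2) that by fastforce
    qed
  qed
  have a_bd: "0 < a" "a < 2 * pi" using a(1) \<theta> b by (auto simp: S_def)
  have "A a \<notin> \<Omega>"
  proof
    assume "A a \<in> \<Omega>"
    moreover have "(A \<longlongrightarrow> A a) (at_left a)"
      using cont[of UNIV] by (simp add: continuous_on_eq_continuous_at continuous_at_imp_continuous_within flip: continuous_within)
    ultimately have "\<forall>\<^sub>F c in at_left a. A c \<in> \<Omega>"
      using \<Omega>_open by (auto simp: tendsto_def)
    moreover have "\<forall>\<^sub>F c in at_left a. 0 < c \<and> c < a"
      using a_bd by (auto simp: eventually_at_left_field)
    ultimately have "\<forall>\<^sub>F c in at_left a. False"
      by eventually_elim (use before closure_subset[of \<Omega>] in auto)
    then show False by simp
  qed
  then have fr: "A a \<in> frontier \<Omega>"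
    using a(1) \<Omega>_open by (simp add: frontier_def interior_open S_def)
  have ne: "A c \<noteq> \<Gamma> s" if "0 < c" "c < 2 * pi" for c
    using that assms(1) sin_gt_zero[of "c/2"] norm_velocity_out[of p]
    by (auto simp: A_def larmor_arc_chord v_def)
  obtain t where t: "s < t" "t < s + L" "\<Gamma> t = A a"
    using ex1_parameter[OF fr ne[OF a_bd]] by blast
  define q :: "real ^ 2" where "q = vector [t, - cos (vec_angle (T t) (v * cis a))]"
  have "arc_step \<Omega> L \<Gamma> \<mu> p q"
    using t a_bd before unfolding arc_step_def s_def[symmetric] v_def[symmetric] A_def[symmetric]
    by (auto simp: q_def)
  moreover have "q' = q''"
    if q': "arc_step \<Omega> L \<Gamma> \<mu> p q'" and q'': "arc_step \<Omega> L \<Gamma> \<mu> p q''" for q' q''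
  proof -
    obtain a' where a': "0 < a'" "a' < 2 * pi" "\<Gamma> (q' $ 1) = A a'"
        "\<And>b. 0 < b \<Longrightarrow> b < a' \<Longrightarrow> A b \<notin> closure \<Omega>"
        "q' $ 2 = - cos (vec_angle (T (q' $ 1)) (v * cis a'))"
      using q' unfolding arc_step_def s_def[symmetric] v_def[symmetric] A_def[symmetric] by blast
    obtain a'' where a'': "0 < a''" "a'' < 2 * pi" "\<Gamma> (q'' $ 1) = A a''"
        "\<And>b. 0 < b \<Longrightarrow> b < a'' \<Longrightarrow> A b \<notin> closure \<Omega>"
        "q'' $ 2 = - cos (vec_angle (T (q'' $ 1)) (v * cis a''))"
      using q'' unfolding arc_step_def s_def[symmetric] v_def[symmetric] A_def[symmetric] by blast
    have eq: "a' = a''"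
      using a' a'' \<Gamma>_closure by (metis linorder_neqE)
    then have "q' $ 1 = q'' $ 1"
      using ex1_parameter[OF \<Gamma>_frontier, of "q' $ 1" s] ne[OF a'(1,2)] a'(3) a''(3) q' q''
      unfolding arc_step_def s_def by metis
    then show ?thesis
      using a'(5) a''(5) eq by (simp add: vec_eq_iff forall_2)
  qed
  ultimately show ?thesis by blast
qed

lemma arc_step_arc_map:
  "\<mu> > 0 \<Longrightarrow> - 1 < p $ 2 \<Longrightarrow> p $ 2 < 1 \<Longrightarrow> arc_step \<Omega> L \<Gamma> \<mu> p (arc_map \<Omega> L \<Gamma> \<mu> p)"
  unfolding arc_map_def by (rule theI'[OF arc_step_ex1])

text \<open>
  At the return point the velocity cannot point strictly to the right of the tangent: followed
  backwards, the arc would then enter \<open>\<Omega>\<close>, where it has not been.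
\<close>

lemma arc_step_velocity:
  assumes "arc_step \<Omega> L \<Gamma> \<mu> p q" "\<mu> > 0"
  obtains a where "0 < a" "a < 2 * pi"
    "\<Gamma> (q $ 1) = larmor_arc \<mu> (\<Gamma> (p $ 1)) (velocity_out \<Gamma> p) a"
    "q $ 2 = - Re (cnj (T (q $ 1)) * (velocity_out \<Gamma> p * cis a))"
    "velocity_in \<Gamma> q = velocity_out \<Gamma> p * cis a"
proof -
  define v where "v = velocity_out \<Gamma> p"
  define A where "A = larmor_arc \<mu> (\<Gamma> (p $ 1)) v"
  obtain a where a: "0 < a" "a < 2 * pi" "\<Gamma> (q $ 1) = A a"
      "\<And>b. 0 < b \<Longrightarrow> b < a \<Longrightarrow> A b \<notin> closure \<Omega>"
      "q $ 2 = - cos (vec_angle (T (q $ 1)) (v * cis a))"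
    using assms unfolding arc_step_def v_def[symmetric] A_def[symmetric] by blast
  define w where "w = cnj (T (q $ 1)) * (v * cis a)"
  have norm_w: "norm w = 1" by (simp add: w_def v_def norm_mult norm_T norm_velocity_out)
  have u: "q $ 2 = - Re w"
    unfolding a(5) w_def by (simp add: cos_vec_angle_unit norm_T norm_mult v_def norm_velocity_out)
  have "0 \<le> Im w"
  proof (rule ccontr)
    assume "\<not> 0 \<le> Im w"
    then have inward: "0 < Im (cnj (T (q $ 1)) * (- (of_real \<mu> * (v * cis a))))"
      using assms(2) mult_pos_neg[of \<mu> "Im w"] by (simp add: w_def algebra_simps)
    have "\<forall>\<^sub>F b in at_right 0. A (a - b) \<in> \<Omega>"
      using inward_curve_enters_\<Omega>[OF reversed_arc_deriv _ inward, of "\<Gamma> (p $ 1)"] a(3)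
      by (simp add: A_def)
    moreover have "\<forall>\<^sub>F b in at_right 0. 0 < b \<and> b < a"
      using a(1) by (auto simp: eventually_at_right_field)
    ultimately have "\<forall>\<^sub>F b in at_right (0::real). False"
      by eventually_elim (use a(4) closure_subset[of \<Omega>] in auto)
    then show False by simp
  qed
  then have "w = cis (arccos (- (q $ 2)))"
    using unit_eq_cis_arccos[OF norm_w] u by simp
  then have "velocity_in \<Gamma> q = v * cis a"
    using T_mult_cnj_T_mult by (metis velocity_in_def w_def)
  then show ?thesis
    using that[of a] a u by (simp add: w_def v_def A_def)
qed

end

section \<open>Derivatives of the two maps\<close>

text \<open>
  The identity behind the value of the determinant; there \<open>a = 2 \<chi>\<close> and the other angles are
  \<open>\<theta>\<^sub>1\<close> and \<open>\<theta>\<^sub>2\<close>.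
\<close>

lemma sin_mult_sin_two_angles:
  "sin (a - x) * sin (a - y) = sin a * sin (a - x - y) + sin x * sin (y::real)"
proof -
  have "sin (a - x) * sin (a - y) = (cos (y - x) - cos (2 * a - x - y)) / 2"
    by (simp add: sin_times_sin algebra_simps)
  moreover have "sin a * sin (a - x - y) = (cos (x + y) - cos (2 * a - x - y)) / 2"
    by (simp add: sin_times_sin algebra_simps)
  moreover have "sin x * sin y = (cos (y - x) - cos (x + y)) / 2"
    using cos_minus[of "x - y"] by (simp add: sin_times_sin)
  ultimately show ?thesis by (simp add: field_simps)
qed

text \<open>
  Implicit differentiation: a constraint that holds at all nearby phase points gives a linear relation
  between the derivatives of the quantities in it.
\<close>

lemma derivative_zero_of_locally_zero:
  assumes "(f has_derivative f') (at x)" "\<forall>\<^sub>F y in nhds x. f y = 0"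
  shows "f' h = 0"
proof -
  have "((\<lambda>_. 0) has_derivative f') (at x)"
    using assms by (intro has_derivative_transform_eventually[OF assms(1)])
      (auto simp: eventually_at_filter elim: eventually_mono dest: eventually_nhds_x_imp_x)
  then have "f' = (\<lambda>_. 0)" using has_derivative_const has_derivative_unique by blast
  then show ?thesis by simp
qed

context smooth_table
begin

lemma eventually_interior_phase:
  fixes p :: "real ^ 2"
  assumes "- 1 < p $ 2" "p $ 2 < 1"
  shows "\<forall>\<^sub>F x in nhds p. - 1 < x $ 2 \<and> x $ 2 < 1"
proof (rule eventually_nhds_in_open[of "{x. - 1 < x $ 2 \<and> x $ 2 < 1}", simplified])
  show "open {x::real^2. - 1 < x $ 2 \<and> x $ 2 < 1}"
    by (intro open_Collect_conj open_Collect_less continuous_intros)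
qed (use assms in auto)

lemma \<Gamma>_comp_deriv:
  "(f has_derivative f') (at x) \<Longrightarrow>
   ((\<lambda>y. \<Gamma> (f y)) has_derivative (\<lambda>h. of_real (f' h) * T (f x))) (at x)"
  using has_derivative_compose[OF _ \<Gamma>_deriv[unfolded has_vector_derivative_def]]
  by (simp add: scaleR_conv_of_real)

lemma T_comp_deriv:
  "(f has_derivative f') (at x) \<Longrightarrow>
   ((\<lambda>y. T (f y)) has_derivative (\<lambda>h. of_real (\<kappa> (f x) * f' h) * (\<i> * T (f x)))) (at x)"
  using has_derivative_compose[OF _ T_deriv[unfolded has_vector_derivative_def]]
  by (simp add: scaleR_conv_of_real mult_ac)

text \<open>
  The direction of the velocity is that of the tangent plus or minus \<open>\<theta>\<close>, and \<open>d\<theta> = du / sin \<theta>\<close> since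
  \<open>u = - cos \<theta>\<close>.
\<close>

lemma velocity_deriv:
  fixes p :: "real ^ 2"
  assumes "- 1 < p $ 2" "p $ 2 < 1"
  defines "\<theta> \<equiv> arccos (- (p $ 2))"
  shows "(velocity_in \<Gamma> has_derivative
           (\<lambda>h. of_real (\<kappa> (p $ 1) * h $ 1 + h $ 2 / sin \<theta>) * (\<i> * velocity_in \<Gamma> p))) (at p)"
    and "(velocity_out \<Gamma> has_derivative
           (\<lambda>h. of_real (\<kappa> (p $ 1) * h $ 1 - h $ 2 / sin \<theta>) * (\<i> * velocity_out \<Gamma> p))) (at p)"
proof -
  have c: "((\<lambda>x. x $ i) has_derivative (\<lambda>h. h $ i)) (at p)" for i :: 2
    by (rule bounded_linear.has_derivative[OF bounded_linear_vec_nth has_derivative_ident])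
  have "sin \<theta> = sqrt (1 - (p $ 2)\<^sup>2)"
    using assms by (simp add: sin_arccos)
  then have \<theta>: "((\<lambda>x. arccos (- (x $ 2))) has_derivative (\<lambda>h. h $ 2 / sin \<theta>)) (at p)"
    using assms by (auto intro!: derivative_eq_intros c simp: divide_inverse)
  have m: "((\<lambda>x. - arccos (- (x $ 2))) has_derivative (\<lambda>h. - (h $ 2 / sin \<theta>))) (at p)"
    by (rule has_derivative_minus[OF \<theta>])
  show "(velocity_in \<Gamma> has_derivative
           (\<lambda>h. of_real (\<kappa> (p $ 1) * h $ 1 + h $ 2 / sin \<theta>) * (\<i> * velocity_in \<Gamma> p))) (at p)"
    unfolding velocity_in_def[abs_def]
    by (rule has_derivative_eq_rhs[OF has_derivative_mult[OF T_comp_deriv[OF c] has_derivative_cis[OF \<theta>]]])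
      (simp add: \<theta>_def scaleR_conv_of_real algebra_simps)
  show "(velocity_out \<Gamma> has_derivative
           (\<lambda>h. of_real (\<kappa> (p $ 1) * h $ 1 - h $ 2 / sin \<theta>) * (\<i> * velocity_out \<Gamma> p))) (at p)"
    unfolding velocity_out_def[abs_def]
    by (rule has_derivative_eq_rhs[OF has_derivative_mult[OF T_comp_deriv[OF c] has_derivative_cis[OF m]]])
      (simp add: \<theta>_def scaleR_conv_of_real algebra_simps)
qed

text \<open>
  The derivative of \<open>u\<close>: it is minus the inner product of the tangent with the
  velocity, and the tangent rotates with the curvature.
\<close>

lemma minus_cos_angle_deriv:
  fixes p :: "real ^ 2"
  assumes s: "(s has_derivative s') (at p)" and w: "(w has_derivative w') (at p)"
  shows "((\<lambda>x. - Re (cnj (T (s x)) * w x)) has_derivative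
          (\<lambda>h. - Re (of_real (\<kappa> (s p) * s' h) * (- \<i>) * cnj (T (s p)) * w p + cnj (T (s p)) * w' h))) (at p)"
proof -
  have "((\<lambda>x. cnj (T (s x))) has_derivative (\<lambda>h. cnj (of_real (\<kappa> (s p) * s' h) * (\<i> * T (s p))))) (at p)"
    by (rule bounded_linear.has_derivative[OF bounded_linear_cnj T_comp_deriv[OF s]])
  from has_derivative_minus[OF bounded_linear.has_derivative[OF bounded_linear_Re has_derivative_mult[OF this w]]]
  show ?thesis by (rule has_derivative_eq_rhs) (simp add: algebra_simps)
qed

text \<open>
  The end of the chord satisfies two equations: seen from the start it lies in the direction of
  the velocity, and \<open>u\<close> is determined there by the tangent and this same velocity.  Differentiating
  the first one, the displacement of the end across the line of flight, \<open>sin \<theta>\<^sub>1 ds\<^sub>1\<close>, is the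
  sideways motion \<open>l d\<phi>\<close> due to the rotation corrected by that of the start.
\<close>

lemma chord_map_derivative:
  fixes p :: "real ^ 2"
  assumes p: "- 1 < p $ 2" "p $ 2 < 1"
    and D: "(chord_map \<Omega> L \<Gamma> has_derivative D) (at p)"
    and q: "chord_map \<Omega> L \<Gamma> p = q"
    and \<theta>0: "\<theta>0 = arccos (- (p $ 2))" and \<theta>1: "\<theta>1 = arccos (- (q $ 2))" "sin \<theta>1 \<noteq> 0"
    and l: "l = dist (\<Gamma> (p $ 1)) (\<Gamma> (q $ 1))"
    and \<phi>: "\<And>h. \<phi> h = \<kappa> (p $ 1) * h $ 1 + h $ 2 / sin \<theta>0"
  shows "D h $ 1 = (l * \<phi> h - sin \<theta>0 * h $ 1) / sin \<theta>1"
    and "D h $ 2 = sin \<theta>1 * (\<kappa> (q $ 1) * D h $ 1 - \<phi> h)"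
proof -
  define f where "f = chord_map \<Omega> L \<Gamma>"
  define v where "v = velocity_in \<Gamma> p"
  have step: "chord_step \<Omega> L \<Gamma> x (f x)" if "- 1 < x $ 2" "x $ 2 < 1" for x
    unfolding f_def using chord_step_chord_map that by blast
  have v0: "v = T (p $ 1) * cis \<theta>0" by (simp add: v_def velocity_in_def \<theta>0)
  have "f p = q" using q by (simp add: f_def)
  then have v1: "v = T (q $ 1) * cis (- \<theta>1)"
    using chord_step_velocity[OF step[OF p]] by (simp add: v_def velocity_out_def \<theta>1)
  have chord: "\<Gamma> (q $ 1) - \<Gamma> (p $ 1) = of_real l * v"
    using step[OF p] norm_velocity_in[of p] \<open>f p = q\<close>
    by (auto simp: chord_step_def l v_def dist_norm norm_mult norm_minus_commute)
  have c: "((\<lambda>x. x $ i) has_derivative (\<lambda>h. h $ i)) (at p)" for i :: 2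
    by (rule bounded_linear.has_derivative[OF bounded_linear_vec_nth has_derivative_ident])
  have fc: "((\<lambda>x. f x $ i) has_derivative (\<lambda>h. D h $ i)) (at p)" for i
    unfolding f_def by (rule bounded_linear.has_derivative[OF bounded_linear_vec_nth D])
  have v': "(velocity_in \<Gamma> has_derivative (\<lambda>h. of_real (\<phi> h) * (\<i> * v))) (at p)"
    using velocity_deriv(1)[OF p] by (simp add: \<phi> \<theta>0 v_def)
  have cnj_v': "((\<lambda>x. cnj (velocity_in \<Gamma> x)) has_derivative (\<lambda>h. cnj (of_real (\<phi> h) * (\<i> * v)))) (at p)"
    by (rule bounded_linear.has_derivative[OF bounded_linear_cnj v'])
  have cnj_v: "cnj v * v = 1"
    using complex_norm_square[of v] norm_velocity_in[of p] by (simp add: mult.commute v_def)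

  \<comment> \<open>To first order, the end of the chord stays on the rotating line of flight.\<close>
  have "((\<lambda>x. Im (cnj (velocity_in \<Gamma> x) * (\<Gamma> (f x $ 1) - \<Gamma> (x $ 1)))) has_derivative
     (\<lambda>h. Im (cnj v * (of_real (D h $ 1) * T (q $ 1) - of_real (h $ 1) * T (p $ 1))
            + cnj (of_real (\<phi> h) * (\<i> * v)) * (\<Gamma> (q $ 1) - \<Gamma> (p $ 1))))) (at p)"
    using bounded_linear.has_derivative[OF bounded_linear_Im has_derivative_mult[OF cnj_v'
        has_derivative_diff[OF \<Gamma>_comp_deriv[OF fc[of 1]] \<Gamma>_comp_deriv[OF c[of 1]]]]]
    by (simp only: v_def[symmetric] \<open>f p = q\<close>)
  moreover have "\<forall>\<^sub>F x in nhds p. Im (cnj (velocity_in \<Gamma> x) * (\<Gamma> (f x $ 1) - \<Gamma> (x $ 1))) = 0"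
    using eventually_interior_phase[OF p]
  proof eventually_elim
    case (elim x)
    then obtain r where "\<Gamma> (f x $ 1) = \<Gamma> (x $ 1) + of_real r * velocity_in \<Gamma> x"
      using step unfolding chord_step_def by blast
    then show ?case by (simp add: complex_norm_square[symmetric] algebra_simps)
  qed
  ultimately have "Im (cnj v * (of_real (D h $ 1) * T (q $ 1) - of_real (h $ 1) * T (p $ 1))
            + cnj (of_real (\<phi> h) * (\<i> * v)) * (\<Gamma> (q $ 1) - \<Gamma> (p $ 1))) = 0"
    by (rule derivative_zero_of_locally_zero)
  also have "cnj v * (of_real (D h $ 1) * T (q $ 1) - of_real (h $ 1) * T (p $ 1))
            + cnj (of_real (\<phi> h) * (\<i> * v)) * (\<Gamma> (q $ 1) - \<Gamma> (p $ 1))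
    = of_real (D h $ 1) * (cnj v * T (q $ 1)) - of_real (h $ 1) * (cnj v * T (p $ 1))
        - of_real (\<phi> h * l) * \<i> * (cnj v * v)"
    unfolding chord by (simp add: algebra_simps)
  also have "cnj v * T (q $ 1) = cis \<theta>1"
    unfolding v1 by (simp add: cis_cnj mult_ac cnj_T_mult_T[unfolded mult.commute[of "cnj _"]] T_mult_cnj_T_mult)
  also have "cnj v * T (p $ 1) = cis (- \<theta>0)"
    unfolding v0 by (simp add: cis_cnj mult_ac cnj_T_mult_T[unfolded mult.commute[of "cnj _"]] T_mult_cnj_T_mult)
  finally have "D h $ 1 * sin \<theta>1 + h $ 1 * sin \<theta>0 - \<phi> h * l = 0"
    by (simp add: cnj_v)
  then show "D h $ 1 = (l * \<phi> h - sin \<theta>0 * h $ 1) / sin \<theta>1"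
    using \<theta>1(2) by (simp add: field_simps)

  have "((\<lambda>x. f x $ 2 - - Re (cnj (T (f x $ 1)) * velocity_in \<Gamma> x)) has_derivative
      (\<lambda>h. D h $ 2 - - Re (of_real (\<kappa> (q $ 1) * D h $ 1) * (- \<i>) * cnj (T (q $ 1)) * v
              + cnj (T (q $ 1)) * (of_real (\<phi> h) * (\<i> * v))))) (at p)"
    using has_derivative_diff[OF fc[of 2] minus_cos_angle_deriv[OF fc[of 1] v']]
    by (simp only: v_def[symmetric] \<open>f p = q\<close>)
  moreover have "\<forall>\<^sub>F x in nhds p. f x $ 2 - - Re (cnj (T (f x $ 1)) * velocity_in \<Gamma> x) = 0"
    using eventually_interior_phase[OF p]
    by eventually_elim (use chord_step_u[OF step] in simp)
  ultimately have "D h $ 2 - - Re (of_real (\<kappa> (q $ 1) * D h $ 1) * (- \<i>) * cnj (T (q $ 1)) * v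
              + cnj (T (q $ 1)) * (of_real (\<phi> h) * (\<i> * v))) = 0"
    by (rule derivative_zero_of_locally_zero)
  also have "of_real (\<kappa> (q $ 1) * D h $ 1) * (- \<i>) * cnj (T (q $ 1)) * v
              + cnj (T (q $ 1)) * (of_real (\<phi> h) * (\<i> * v))
     = of_real (\<phi> h - \<kappa> (q $ 1) * D h $ 1) * (\<i> * (cnj (T (q $ 1)) * v))"
    by (simp add: algebra_simps)
  also have "cnj (T (q $ 1)) * v = cis (- \<theta>1)" unfolding v1 by (rule cnj_T_mult_T_mult)
  finally show "D h $ 2 = sin \<theta>1 * (\<kappa> (q $ 1) * D h $ 1 - \<phi> h)"
    by (simp add: algebra_simps)
qed

text \<open>
  The center \<open>C\<close> of the Larmor circle depends differentiably on the initial phase point, and its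
  distance to the end of the arc stays equal to \<open>\<mu>\<close>.  The velocity at the end is the radius
  vector rotated by a right angle and scaled by \<open>1/\<mu>\<close>.  Describing the arc in this way avoids the
  swept angle as an additional unknown, whose differentiability would have to be proved.
\<close>

lemma arc_map_derivative:
  fixes p :: "real ^ 2"
  assumes p: "- 1 < p $ 2" "p $ 2 < 1" and \<mu>: "\<mu> > 0"
    and D: "(arc_map \<Omega> L \<Gamma> \<mu> has_derivative D) (at p)"
    and q: "arc_map \<Omega> L \<Gamma> \<mu> p = q"
    and \<theta>1: "\<theta>1 = arccos (- (p $ 2))" and \<theta>2: "\<theta>2 = arccos (- (q $ 2))" "sin \<theta>2 \<noteq> 0"
    and turn: "velocity_in \<Gamma> q = velocity_out \<Gamma> p * cis a"
    and \<phi>: "\<And>h. \<phi> h = \<kappa> (p $ 1) * h $ 1 - h $ 2 / sin \<theta>1"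
  shows "D h $ 1 = (sin (a - \<theta>1) * h $ 1 - \<mu> * sin a * \<phi> h) / sin \<theta>2"
    and "D h $ 2 = - \<kappa> (q $ 1) * sin \<theta>2 * D h $ 1 + sin (a - \<theta>1 - \<theta>2) * h $ 1 / \<mu>
                   - sin (a - \<theta>2) * \<phi> h"
proof -
  define f where "f = arc_map \<Omega> L \<Gamma> \<mu>"
  define v where "v = velocity_out \<Gamma> p"
  define C where "C x = \<Gamma> (x $ 1) + of_real \<mu> * (\<i> * velocity_out \<Gamma> x)" for x
  define R where "R x = \<Gamma> (f x $ 1) - C x" for x
  have step: "arc_step \<Omega> L \<Gamma> \<mu> x (f x)" if "- 1 < x $ 2" "x $ 2 < 1" for x
    unfolding f_def using arc_step_arc_map[OF \<mu>] that by blast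
  have "f p = q" using q by (simp add: f_def)
  have radius: "R x = of_real \<mu> * - \<i> * velocity_in \<Gamma> (f x)"
    and u: "f x $ 2 = - Re (cnj (T (f x $ 1)) * (\<i> / of_real \<mu> * R x))"
    if x: "- 1 < x $ 2" "x $ 2 < 1" for x
  proof -
    obtain b where b: "\<Gamma> (f x $ 1) = larmor_arc \<mu> (\<Gamma> (x $ 1)) (velocity_out \<Gamma> x) b"
      "f x $ 2 = - Re (cnj (T (f x $ 1)) * (velocity_out \<Gamma> x * cis b))"
      "velocity_in \<Gamma> (f x) = velocity_out \<Gamma> x * cis b"
      using arc_step_velocity[OF step[OF x] \<mu>] by metis
    show *: "R x = of_real \<mu> * - \<i> * velocity_in \<Gamma> (f x)"
      by (simp add: R_def C_def b(1,3) larmor_arc_def)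
    show "f x $ 2 = - Re (cnj (T (f x $ 1)) * (\<i> / of_real \<mu> * R x))"
      unfolding * b(2) b(3) using \<mu> by simp
  qed
  have v1: "v = T (p $ 1) * cis (- \<theta>1)" by (simp add: v_def velocity_out_def \<theta>1)
  have v2: "v * cis a = T (q $ 1) * cis \<theta>2"
    using turn by (simp add: v_def velocity_in_def \<theta>2)
  have c: "((\<lambda>x. x $ i) has_derivative (\<lambda>h. h $ i)) (at p)" for i :: 2
    by (rule bounded_linear.has_derivative[OF bounded_linear_vec_nth has_derivative_ident])
  have fc: "((\<lambda>x. f x $ i) has_derivative (\<lambda>h. D h $ i)) (at p)" for i
    unfolding f_def by (rule bounded_linear.has_derivative[OF bounded_linear_vec_nth D])
  have v': "(velocity_out \<Gamma> has_derivative (\<lambda>h. of_real (\<phi> h) * (\<i> * v))) (at p)"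
    using velocity_deriv(2)[OF p] by (simp add: \<phi> \<theta>1 v_def)
  define R' where "R' h = of_real (D h $ 1) * T (q $ 1) - of_real (h $ 1) * T (p $ 1)
      + of_real (\<mu> * \<phi> h) * v" for h
  have R': "(R has_derivative R') (at p)"
    unfolding R_def[abs_def] C_def
    by (rule has_derivative_eq_rhs[OF has_derivative_diff[OF \<Gamma>_comp_deriv[OF fc[of 1]]
          has_derivative_add[OF \<Gamma>_comp_deriv[OF c[of 1]]
            has_derivative_mult_right[OF has_derivative_mult_right[OF v']]]]])
      (simp add: R'_def[abs_def] \<open>f p = q\<close> algebra_simps)
  have Rp: "R p = of_real \<mu> * - \<i> * (v * cis a)"
    using radius[OF p] turn by (simp add: \<open>f p = q\<close> v_def)
  have cnj_v: "cnj v * v = 1"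
    using complex_norm_square[of v] norm_velocity_out[of p] by (simp add: mult.commute v_def)

  \<comment> \<open>The end stays on the Larmor circle.\<close>
  have "((\<lambda>x. R x \<bullet> R x - \<mu>\<^sup>2) has_derivative (\<lambda>h. R p \<bullet> R' h + R' h \<bullet> R p - 0)) (at p)"
    by (intro has_derivative_diff has_derivative_inner R' has_derivative_const)
  moreover have "\<forall>\<^sub>F x in nhds p. R x \<bullet> R x - \<mu>\<^sup>2 = 0"
    using eventually_interior_phase[OF p]
    by eventually_elim
      (use radius \<mu> in \<open>simp add: dot_square_norm norm_mult norm_velocity_in\<close>)
  ultimately have "R p \<bullet> R' h + R' h \<bullet> R p - 0 = 0"
    by (rule derivative_zero_of_locally_zero)
  then have "Re (cnj (R p) * R' h) = 0"
    unfolding inner_eq_Re_cnj_mult[symmetric] by (simp add: inner_commute)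
  also have "cnj (R p) * R' h = of_real \<mu> * (\<i> * (of_real (D h $ 1) * (cnj (v * cis a) * T (q $ 1))
      - of_real (h $ 1) * (cis (- a) * (cnj v * T (p $ 1)))
      + of_real (\<mu> * \<phi> h) * (cis (- a) * (cnj v * v))))"
    unfolding Rp R'_def by (simp add: algebra_simps cis_cnj)
  also have "cnj (v * cis a) * T (q $ 1) = cis (- \<theta>2)"
    unfolding v2 by (simp add: cis_cnj mult_ac cnj_T_mult_T[unfolded mult.commute[of "cnj _"]] T_mult_cnj_T_mult)
  also have "cnj v * T (p $ 1) = cis \<theta>1"
    unfolding v1 by (simp add: cis_cnj mult_ac cnj_T_mult_T[unfolded mult.commute[of "cnj _"]] T_mult_cnj_T_mult)
  finally have "Re (of_real \<mu> * (\<i> * (of_real (D h $ 1) * cis (- \<theta>2)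
      - of_real (h $ 1) * cis (\<theta>1 - a) + of_real (\<mu> * \<phi> h) * cis (- a)))) = 0"
    by (simp add: cnj_v cis_mult)
  then have "D h $ 1 * sin \<theta>2 + h $ 1 * sin (\<theta>1 - a) + \<mu> * \<phi> h * sin a = 0"
    using \<mu> by simp
  moreover have "sin (\<theta>1 - a) = - sin (a - \<theta>1)"
    using sin_minus[of "a - \<theta>1"] by simp
  ultimately show "D h $ 1 = (sin (a - \<theta>1) * h $ 1 - \<mu> * sin a * \<phi> h) / sin \<theta>2"
    using \<theta>2(2) by (simp add: field_simps)

  have w': "((\<lambda>x. \<i> / of_real \<mu> * R x) has_derivative (\<lambda>h. \<i> / of_real \<mu> * R' h)) (at p)"
    by (intro has_derivative_mult_right R')
  have wp: "\<i> / of_real \<mu> * R p = v * cis a" using \<mu> by (simp add: Rp)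
  have "((\<lambda>x. f x $ 2 - - Re (cnj (T (f x $ 1)) * (\<i> / of_real \<mu> * R x))) has_derivative
      (\<lambda>h. D h $ 2 - - Re (of_real (\<kappa> (q $ 1) * D h $ 1) * (- \<i>) * cnj (T (q $ 1)) * (v * cis a)
              + cnj (T (q $ 1)) * (\<i> / of_real \<mu> * R' h)))) (at p)"
    using has_derivative_diff[OF fc[of 2] minus_cos_angle_deriv[OF fc[of 1] w']]
    by (simp only: wp \<open>f p = q\<close>)
  moreover have "\<forall>\<^sub>F x in nhds p. f x $ 2 - - Re (cnj (T (f x $ 1)) * (\<i> / of_real \<mu> * R x)) = 0"
    using eventually_interior_phase[OF p]
    by eventually_elim (use u in simp)
  ultimately have "D h $ 2 - - Re (of_real (\<kappa> (q $ 1) * D h $ 1) * (- \<i>) * cnj (T (q $ 1)) * (v * cis a)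
              + cnj (T (q $ 1)) * (\<i> / of_real \<mu> * R' h)) = 0"
    by (rule derivative_zero_of_locally_zero)
  also have "of_real (\<kappa> (q $ 1) * D h $ 1) * (- \<i>) * cnj (T (q $ 1)) * (v * cis a)
              + cnj (T (q $ 1)) * (\<i> / of_real \<mu> * R' h)
     = - of_real (\<kappa> (q $ 1) * D h $ 1) * (\<i> * (cnj (T (q $ 1)) * (v * cis a)))
       + \<i> / of_real \<mu> * (of_real (D h $ 1) * (cnj (T (q $ 1)) * T (q $ 1))
           - of_real (h $ 1) * (cnj (T (q $ 1)) * T (p $ 1))
           + of_real (\<mu> * \<phi> h) * (cnj (T (q $ 1)) * v))"
    unfolding R'_def by (simp add: algebra_simps)
  also have "cnj (T (q $ 1)) * (v * cis a) = cis \<theta>2"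
    unfolding v2 by (rule cnj_T_mult_T_mult)
  also have "cnj (T (q $ 1)) * v = cis (\<theta>2 - a)"
  proof -
    have "cnj (T (q $ 1)) * v = cnj (T (q $ 1)) * (v * cis a) * cis (- a)"
      by (simp add: cis_mult mult.assoc)
    also have "\<dots> = cis (\<theta>2 - a)"
      unfolding v2 cnj_T_mult_T_mult by (simp add: cis_mult)
    finally show ?thesis .
  qed
  also have "cnj (T (q $ 1)) * T (p $ 1) = cis (\<theta>1 + \<theta>2 - a)"
  proof -
    have "T (p $ 1) = v * cis \<theta>1" by (simp add: v1 cis_mult mult.assoc)
    then have "cnj (T (q $ 1)) * T (p $ 1) = cnj (T (q $ 1)) * v * cis \<theta>1" by simp
    then show ?thesis
      unfolding \<open>cnj (T (q $ 1)) * v = cis (\<theta>2 - a)\<close> by (simp add: cis_mult algebra_simps)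
  qed
  finally have "D h $ 2 + \<kappa> (q $ 1) * D h $ 1 * sin \<theta>2
      + (sin (\<theta>1 + \<theta>2 - a) * h $ 1 - \<mu> * \<phi> h * sin (\<theta>2 - a)) / \<mu> = 0"
    using \<mu> by (simp add: cnj_T_mult_T field_simps)
  moreover have "sin (\<theta>1 + \<theta>2 - a) = - sin (a - \<theta>1 - \<theta>2)" "sin (\<theta>2 - a) = - sin (a - \<theta>2)"
    using sin_minus[of "a - \<theta>1 - \<theta>2"] sin_minus[of "a - \<theta>2"] by (simp_all add: algebra_simps)
  ultimately show "D h $ 2 = - \<kappa> (q $ 1) * sin \<theta>2 * D h $ 1 + sin (a - \<theta>1 - \<theta>2) * h $ 1 / \<mu>
                   - sin (a - \<theta>2) * \<phi> h"
    using \<mu> by (simp add: field_simps)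
qed

end

section \<open>The return map\<close>

lemma abs_cos_less_1: "sin x \<noteq> 0 \<Longrightarrow> \<bar>cos (x::real)\<bar> < 1"
proof -
  assume "sin x \<noteq> 0"
  then have "0 < (sin x)\<^sup>2" by simp
  then have "(cos x)\<^sup>2 < 1" using sin_cos_squared_add[of x] by linarith
  then show ?thesis by (simp add: abs_square_less_1)
qed

text \<open>
  Here \<open>d x y\<close> and \<open>e x y\<close> are the changes of \<open>s\<^sub>2\<close> and \<open>u\<^sub>2\<close> for a change \<open>x\<close> of \<open>s\<^sub>1\<close> and a rotation
  \<open>y\<close> of the velocity, and \<open>(x1, k0)\<close> and \<open>(x2, 1 / n0)\<close> are the values of \<open>(x, y)\<close> for unit changes of \<open>s\<^sub>0\<close> and \<open>u\<^sub>0\<close>;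
  \<open>n0\<close>, \<open>n1\<close> and \<open>n2\<close> stand for the sines of the angles, and \<open>m\<close> for \<open>1/\<mu>\<close>.  The term of \<open>e\<close> with the
  curvature \<open>k2\<close> is a multiple of \<open>d\<close> and drops out of the determinant; the rest is
  the product of two determinants, which are \<open>- 1 / n1\<close> and, by the assumption on \<open>A * C\<close>, \<open>- n1\<close>.
\<close>

lemma det_from_transverse_area:
  fixes A B C S m l1 k0 k2 n0 n1 n2 :: real
  assumes n: "n0 \<noteq> 0" "n1 \<noteq> 0" "n2 \<noteq> 0" and AC: "A * C = S * m * B + n1 * n2"
  defines "d \<equiv> \<lambda>x y. (A * x - B * y) / n2"
  defines "e \<equiv> \<lambda>x y. - k2 * n2 * d x y + S * m * x - C * y"
  defines "x1 \<equiv> (l1 * k0 - n0) / n1" and "x2 \<equiv> l1 / (n0 * n1)"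
  shows "d x1 k0 * e x2 (1 / n0) - d x2 (1 / n0) * e x1 k0 = 1"
proof -
  have d: "n2 * d x y = A * x - B * y" for x y
    using n(3) by (simp add: d_def)
  then have e: "e x y = - k2 * (A * x - B * y) + S * m * x - C * y" for x y
    by (simp add: e_def mult.assoc)
  have "n2 * (d x1 k0 * e x2 (1 / n0) - d x2 (1 / n0) * e x1 k0)
      = (n2 * d x1 k0) * e x2 (1 / n0) - (n2 * d x2 (1 / n0)) * e x1 k0"
    by (simp add: algebra_simps)
  also have "\<dots> = (A * x1 - B * k0) * (S * m * x2 - C * (1 / n0)) - (A * x2 - B * (1 / n0)) * (S * m * x1 - C * k0)"
    unfolding d e by (simp add: algebra_simps)
  also have "\<dots> = (x1 * (1 / n0) - k0 * x2) * (S * m * B - A * C)"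
    by (simp add: algebra_simps)
  also have "x1 * (1 / n0) - k0 * x2 = - 1 / n1"
    using n by (simp add: x1_def x2_def field_simps)
  also have "- 1 / n1 * (S * m * B - A * C) = n2"
    using n by (simp add: AC)
  finally show ?thesis using n(3) by simp
qed

context smooth_table
begin

lemma chord_arc_angle:
  assumes chord: "chord_step \<Omega> L \<Gamma> p q" and arc: "arc_step \<Omega> L \<Gamma> \<mu> q r" and \<mu>: "\<mu> > 0"
  defines "chi \<equiv> ccw_angle (\<Gamma> (q $ 1) - \<Gamma> (p $ 1)) (\<Gamma> (r $ 1) - \<Gamma> (q $ 1))"
  shows "0 < chi" "chi < pi" "velocity_in \<Gamma> r = velocity_out \<Gamma> q * cis (2 * chi)"
    "dist (\<Gamma> (q $ 1)) (\<Gamma> (r $ 1)) = 2 * \<mu> * sin chi"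
proof -
  define v where "v = velocity_in \<Gamma> p"
  have v: "velocity_out \<Gamma> q = v" using chord_step_velocity[OF chord] by (simp add: v_def)
  obtain l where l: "l > 0" "\<Gamma> (q $ 1) - \<Gamma> (p $ 1) = of_real l * v"
    using chord unfolding chord_step_def v_def by auto
  obtain a where a: "0 < a" "a < 2 * pi" "\<Gamma> (r $ 1) = larmor_arc \<mu> (\<Gamma> (q $ 1)) v a"
      "velocity_in \<Gamma> r = v * cis a"
    using arc_step_velocity[OF arc \<mu>] unfolding v by metis
  have w: "\<Gamma> (r $ 1) - \<Gamma> (q $ 1) = of_real (2 * \<mu> * sin (a/2)) * (v * cis (a/2))"
    using a(3) by (simp add: larmor_arc_chord)
  have pos: "0 < 2 * \<mu> * sin (a/2)" using \<mu> a sin_gt_zero[of "a/2"] by simp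
  have "norm v = 1" by (simp add: v_def norm_velocity_in)
  then have "v \<noteq> 0" by auto
  then have "of_real (2 * \<mu> * sin (a/2) / l) * exp (\<i> * of_real (a/2))
      = (\<Gamma> (r $ 1) - \<Gamma> (q $ 1)) / (\<Gamma> (q $ 1) - \<Gamma> (p $ 1))"
    using l(1) unfolding w l(2) cis_conv_exp[symmetric] by simp
  then have chi_eq: "chi = a/2"
    unfolding chi_def ccw_angle_def using a l(1) pos
    by (intro Arg2pi_unique[of "2 * \<mu> * sin (a/2) / l"]) (auto intro: divide_pos_pos)
  then have "2 * chi = a" by simp
  then show "0 < chi" "chi < pi" "velocity_in \<Gamma> r = velocity_out \<Gamma> q * cis (2 * chi)"
    using a(1,2) by (auto simp only: a(4) v)
  have "dist (\<Gamma> (q $ 1)) (\<Gamma> (r $ 1)) = norm (\<Gamma> (r $ 1) - \<Gamma> (q $ 1))"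
    by (simp add: dist_norm norm_minus_commute)
  then show "dist (\<Gamma> (q $ 1)) (\<Gamma> (r $ 1)) = 2 * \<mu> * sin chi"
    unfolding w using pos \<open>norm v = 1\<close> by (simp only: norm_mult norm_of_real norm_cis chi_eq)
qed

end

theorem corollary1:
  fixes \<Omega> :: "complex set" and \<Gamma> :: "real \<Rightarrow> complex" and L \<mu> :: real and k :: nat
    and s0 s1 s2 \<theta>0 \<theta>1 \<theta>2 \<kappa>0 \<kappa>2 l1 l2 chi :: real
  assumes table: "billiard_table \<Omega> k L \<Gamma>" and k: "k \<ge> 3" and \<mu>: "\<mu> > 0"
    and \<theta>: "\<theta>0 \<in> {0..pi}" "\<theta>1 \<in> {0..pi}" "\<theta>2 \<in> {0..pi}"
    and defined: "sin \<theta>0 \<noteq> 0" "sin \<theta>1 \<noteq> 0" "sin \<theta>2 \<noteq> 0"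
    and T1: "chord_map \<Omega> L \<Gamma> (vector [s0, - cos \<theta>0]) = vector [s1, - cos \<theta>1]"
    and T2: "arc_map \<Omega> L \<Gamma> \<mu> (vector [s1, - cos \<theta>1]) = vector [s2, - cos \<theta>2]"
    and diff_T1: "chord_map \<Omega> L \<Gamma> differentiable (at (vector [s0, - cos \<theta>0]))"
    and diff_T2: "arc_map \<Omega> L \<Gamma> \<mu> differentiable (at (vector [s1, - cos \<theta>1]))"
    and \<kappa>: "\<kappa>0 = curvature \<Gamma> s0" "\<kappa>2 = curvature \<Gamma> s2"
    and l: "l1 = dist (\<Gamma> s0) (\<Gamma> s1)" "l2 = dist (\<Gamma> s1) (\<Gamma> s2)"
    and chi: "chi = ccw_angle (\<Gamma> s1 - \<Gamma> s0) (\<Gamma> s2 - \<Gamma> s1)"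
  shows "return_map \<Omega> L \<Gamma> \<mu> differentiable (at (vector [s0, - cos \<theta>0])) \<and>
    jacobian (return_map \<Omega> L \<Gamma> \<mu>) (at (vector [s0, - cos \<theta>0])) =
      vector [
        vector [
          (\<kappa>0 * l1 * sin (2 * chi - \<theta>1) - sin \<theta>0 * sin (2 * chi - \<theta>1) - \<kappa>0 * l2 * cos chi * sin \<theta>1)
            / (sin \<theta>1 * sin \<theta>2),
          (l1 * sin (2 * chi - \<theta>1) - l2 * cos chi * sin \<theta>1) / (sin \<theta>0 * sin \<theta>1 * sin \<theta>2)],
        vector [
          \<kappa>2 * sin \<theta>0 * sin (2 * chi - \<theta>1) / sin \<theta>1
            + 2 * sin chi * sin (2 * chi - \<theta>1 - \<theta>2) * (\<kappa>0 * l1 - sin \<theta>0) / (l2 * sin \<theta>1)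
            - \<kappa>0 * (sin (2 * chi - \<theta>2) + \<kappa>2 * l1 * sin (2 * chi - \<theta>1) / sin \<theta>1 - \<kappa>2 * l2 * cos chi),
          (\<kappa>2 * l2 * cos chi - sin (2 * chi - \<theta>2)) / sin \<theta>0
            + (2 * l1 * sin chi * sin (2 * chi - \<theta>1 - \<theta>2) - \<kappa>2 * l1 * l2 * sin (2 * chi - \<theta>1))
                / (l2 * sin \<theta>0 * sin \<theta>1)]] \<and>
    det (jacobian (return_map \<Omega> L \<Gamma> \<mu>) (at (vector [s0, - cos \<theta>0]))) = 1"
proof -
  interpret smooth_table \<Omega> k L \<Gamma>
    using table k by unfold_locales auto
  define p q r :: "real ^ 2"
    where "p = vector [s0, - cos \<theta>0]" and "q = vector [s1, - cos \<theta>1]" and "r = vector [s2, - cos \<theta>2]"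
  have comps: "p $ 1 = s0" "p $ 2 = - cos \<theta>0" "q $ 1 = s1" "q $ 2 = - cos \<theta>1" "r $ 1 = s2" "r $ 2 = - cos \<theta>2"
    by (simp_all add: p_def q_def r_def)
  have p: "- 1 < p $ 2" "p $ 2 < 1" and q: "- 1 < q $ 2" "q $ 2 < 1"
    using abs_cos_less_1[OF defined(1)] abs_cos_less_1[OF defined(2)] by (auto simp: comps)
  have angles: "\<theta>0 = arccos (- (p $ 2))" "\<theta>1 = arccos (- (q $ 2))" "\<theta>2 = arccos (- (r $ 2))"
    using \<theta> by (simp_all add: comps arccos_cos)
  have maps: "chord_map \<Omega> L \<Gamma> p = q" "arc_map \<Omega> L \<Gamma> \<mu> q = r"
    using T1 T2 by (simp_all add: p_def q_def r_def)
  obtain D where D: "(chord_map \<Omega> L \<Gamma> has_derivative D) (at p)"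
    using diff_T1 by (auto simp: differentiable_def p_def)
  obtain E where E: "(arc_map \<Omega> L \<Gamma> \<mu> has_derivative E) (at q)"
    using diff_T2 by (auto simp: differentiable_def q_def)
  have R: "(return_map \<Omega> L \<Gamma> \<mu> has_derivative E \<circ> D) (at p)"
    unfolding return_map_def using diff_chain_at[OF D] E maps(1) by simp
  have chord: "chord_step \<Omega> L \<Gamma> p q" and arc: "arc_step \<Omega> L \<Gamma> \<mu> q r"
    using chord_step_chord_map[OF p] arc_step_arc_map[OF \<mu> q] by (simp_all add: maps)
  note arc_angle = chord_arc_angle[OF chord arc \<mu>, unfolded comps, folded chi l]
  have "sin chi \<noteq> 0" using sin_gt_zero arc_angle(1,2) by force
  have l2: "l2 \<noteq> 0" "1 / \<mu> = 2 * sin chi / l2" "\<mu> * sin (2 * chi) = l2 * cos chi"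
    using \<mu> \<open>sin chi \<noteq> 0\<close> by (simp_all add: arc_angle(4) sin_double)
  define \<phi> where "\<phi> h = \<kappa>0 * h $ 1 + h $ 2 / sin \<theta>0" for h :: "real ^ 2"
  define x where "x h = (l1 * \<phi> h - sin \<theta>0 * h $ 1) / sin \<theta>1" for h :: "real ^ 2"
  have D1: "D h $ 1 = x h" and D2: "D h $ 2 = sin \<theta>1 * (curvature \<Gamma> s1 * D h $ 1 - \<phi> h)" for h
    using chord_map_derivative[OF p D maps(1) angles(1,2) defined(2) refl, of \<phi> h]
    by (simp_all add: comps l \<kappa> \<phi>_def x_def)
  \<comment> \<open>The velocity rotates equally at both ends of the chord; here the curvature at its end cancels.\<close>
  have \<phi>: "curvature \<Gamma> s1 * D h $ 1 - D h $ 2 / sin \<theta>1 = \<phi> h" for h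
    using defined by (simp add: D2)
  define d where "d h = (sin (2 * chi - \<theta>1) * x h - l2 * cos chi * \<phi> h) / sin \<theta>2" for h
  define e where "e h = - \<kappa>2 * sin \<theta>2 * d h + sin (2 * chi - \<theta>1 - \<theta>2) * (2 * sin chi / l2) * x h
      - sin (2 * chi - \<theta>2) * \<phi> h" for h
  have ED: "E (D h) $ 1 = d h" "E (D h) $ 2 = e h" for h
    using arc_map_derivative[OF q \<mu> E maps(2) angles(2,3) defined(3) arc_angle(3) refl, of "D h"]
    unfolding comps \<phi> \<kappa>(2)[symmetric]
    by (simp_all add: D1 d_def e_def flip: l2(2,3))
  have J: "jacobian (return_map \<Omega> L \<Gamma> \<mu>) (at p) $ 1 $ j = d (axis j 1)"
    "jacobian (return_map \<Omega> L \<Gamma> \<mu>) (at p) $ 2 $ j = e (axis j 1)" for j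
    using frechet_derivative_at[OF R] by (simp_all add: jacobian_def matrix_def ED flip: frechet_derivative_at[OF R])
  have \<phi>_axis: "\<phi> (axis 1 1) = \<kappa>0" "\<phi> (axis 2 1) = 1 / sin \<theta>0"
    by (simp_all add: \<phi>_def axis_def)
  have x_axis: "x (axis 1 1) = (l1 * \<kappa>0 - sin \<theta>0) / sin \<theta>1" "x (axis 2 1) = l1 / (sin \<theta>0 * sin \<theta>1)"
    by (simp_all add: x_def \<phi>_axis) (simp_all add: axis_def)
  have "sin (2 * chi - \<theta>1) * sin (2 * chi - \<theta>2)
      = sin (2 * chi - \<theta>1 - \<theta>2) * (2 * sin chi / l2) * (l2 * cos chi) + sin \<theta>1 * sin \<theta>2"
    unfolding sin_mult_sin_two_angles using l2(1) by (simp add: sin_double)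
  from det_from_transverse_area[OF defined this, of l1 \<kappa>0 \<kappa>2]
  have "det (jacobian (return_map \<Omega> L \<Gamma> \<mu>) (at p)) = 1"
    unfolding det_2 J d_def e_def \<phi>_axis x_axis .
  moreover have "d (axis 1 1) = (\<kappa>0 * l1 * sin (2 * chi - \<theta>1) - sin \<theta>0 * sin (2 * chi - \<theta>1)
        - \<kappa>0 * l2 * cos chi * sin \<theta>1) / (sin \<theta>1 * sin \<theta>2)"
    "d (axis 2 1) = (l1 * sin (2 * chi - \<theta>1) - l2 * cos chi * sin \<theta>1) / (sin \<theta>0 * sin \<theta>1 * sin \<theta>2)"
    using defined unfolding d_def \<phi>_axis x_axis by (simp_all add: divide_simps) (simp_all add: algebra_simps)
  moreover have "e (axis 1 1) = \<kappa>2 * sin \<theta>0 * sin (2 * chi - \<theta>1) / sin \<theta>1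
            + 2 * sin chi * sin (2 * chi - \<theta>1 - \<theta>2) * (\<kappa>0 * l1 - sin \<theta>0) / (l2 * sin \<theta>1)
            - \<kappa>0 * (sin (2 * chi - \<theta>2) + \<kappa>2 * l1 * sin (2 * chi - \<theta>1) / sin \<theta>1 - \<kappa>2 * l2 * cos chi)"
    "e (axis 2 1) = (\<kappa>2 * l2 * cos chi - sin (2 * chi - \<theta>2)) / sin \<theta>0
            + (2 * l1 * sin chi * sin (2 * chi - \<theta>1 - \<theta>2) - \<kappa>2 * l1 * l2 * sin (2 * chi - \<theta>1))
                / (l2 * sin \<theta>0 * sin \<theta>1)"
    using defined l2(1) unfolding e_def d_def \<phi>_axis x_axis
    by (simp_all add: divide_simps) (simp_all add: algebra_simps)
  moreover have "return_map \<Omega> L \<Gamma> \<mu> differentiable (at p)"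
    using R by (auto simp: differentiable_def)
  ultimately show ?thesis
    unfolding p_def[symmetric] by (simp add: vec_eq_iff forall_2 J)
qed

end
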